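(* Let $G$ be a finite simple graph, let $\Sigma$ be a finite collection of cliques of $G$ (possibly repeated, not necessarily of the same size), and let $\widetilde G$ be the subgraph of $G$ induced by the vertices that do not belong to any clique of $\Sigma$. Then for all $k\ge 0$, $$H^k(\mathcal L(G,\Sigma))\cong H^k(\mathcal L(\widetilde G+|\Sigma|K_1))$$ as real vector spaces.
   Context: Let $G$ be a finite simple graph with vertices $V(G)=\{1,\dots,n\}$ and edge set $E(G)$, and let $\Sigma=\{\sigma_1,\dots,\sigma_s\}$ be a collection of cliques of $G$ (possibly repeated; $|\Sigma|=s$ counts repetitions). $\mathcal L(G,\Sigma)$ is the real Lie algebra with basis $x_1,\dots,x_n$, $y_1,\dots,y_s$, and $x_{i,j}$ for $1\le i<j\le n$ with $\{i,j\}\in E(G)$, whose bilinear skew-symmetric bracket is given by: (1) $[x_i,x_j]=x_{i,j}$ whenever $i<j$ and $\{i,j\}\in E(G)$; (2) $[x_i,y_k]=|\{i\}\cap V(\sigma_k)|\,x_i$ for all $i,k$; (3) $[x_{i,j},y_k]=|\{i,j\}\cap V(\sigma_k)|\,x_{i,j}$ for all edges $\{i,j\}$ with $i<j$ and all $k$; all brackets of basis elements not determined by these and skew-symmetry are zero. When $\Sigma=\emptyset$ one writes $\mathcal L(G)=\mathcal L(G,\emptyset)$; this is the (2-step nilpotent) Dani-Mainkar Lie algebra of $G$. $H^k(-)$ denotes Chevalley-Eilenberg cohomology with trivial real coefficients. $G_1+G_2$ denotes the disjoint union of graphs, and $mK_1$ is the edgeless graph on $m$ vertices. *)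

theory Defs
  imports Complex_Main "HOL-Library.Function_Algebras" "HOL-Library.Set_Algebras"
begin

section \<open>Graphs\<close>

record 'a graph =
  verts :: "'a set"
  edges :: "'a set set"

definition finite_simple_graph :: "'a graph \<Rightarrow> bool" where
  "finite_simple_graph G \<longleftrightarrow> finite (verts G) \<and>
     (\<forall>e\<in>edges G. \<exists>u\<in>verts G. \<exists>v\<in>verts G. u \<noteq> v \<and> e = {u, v})"

text \<open>A clique is identified with its vertex set.\<close>

definition clique :: "'a graph \<Rightarrow> 'a set \<Rightarrow> bool" where
  "clique G C \<longleftrightarrow> C \<subseteq> verts G \<and> (\<forall>u\<in>C. \<forall>v\<in>C. u \<noteq> v \<longrightarrow> {u, v} \<in> edges G)"

definition induced_subgraph :: "'a graph \<Rightarrow> 'a set \<Rightarrow> 'a graph" where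
  "induced_subgraph G W = \<lparr>verts = verts G \<inter> W, edges = {e \<in> edges G. e \<subseteq> W}\<rparr>"

definition graph_disjoint_union :: "'a graph \<Rightarrow> 'b graph \<Rightarrow> ('a + 'b) graph" where
  "graph_disjoint_union G H =
     \<lparr>verts = verts G <+> verts H,
      edges = (\<lambda>e. Inl ` e) ` edges G \<union> (\<lambda>e. Inr ` e) ` edges H\<rparr>"

definition edgeless_graph :: "nat \<Rightarrow> nat graph" where
  "edgeless_graph m = \<lparr>verts = {1..m}, edges = {}\<rparr>"

text \<open>
  The sign convention for the generators attached to edges uses a linear order on the
  vertices. On a disjoint union all vertices of the first graph precede those of the second.
\<close>

instantiation sum :: (linorder, linorder) linorder
begin

fun less_eq_sum :: "'a + 'b \<Rightarrow> 'a + 'b \<Rightarrow> bool" where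
  "less_eq_sum (Inl a) (Inl b) = (a \<le> b)"
| "less_eq_sum (Inl a) (Inr b) = True"
| "less_eq_sum (Inr a) (Inl b) = False"
| "less_eq_sum (Inr a) (Inr b) = (a \<le> b)"

definition less_sum :: "'a + 'b \<Rightarrow> 'a + 'b \<Rightarrow> bool" where
  "less_sum x y \<longleftrightarrow> x \<le> y \<and> \<not> y \<le> x"

instance
proof
  fix x y z :: "'a + 'b"
  show "x < y \<longleftrightarrow> x \<le> y \<and> \<not> y \<le> x" by (rule less_sum_def)
  show "x \<le> x" by (cases x) auto
  show "x \<le> y \<Longrightarrow> y \<le> z \<Longrightarrow> x \<le> z" by (cases x; cases y; cases z) auto
  show "x \<le> y \<Longrightarrow> y \<le> x \<Longrightarrow> x = y" by (cases x; cases y) auto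
  show "x \<le> y \<or> y \<le> x" by (cases x; cases y) auto
qed

end

section \<open>Functions into a real vector space\<close>

instantiation "fun" :: (type, real_vector) real_vector
begin

definition scaleR_fun :: "real \<Rightarrow> ('a \<Rightarrow> 'b) \<Rightarrow> 'a \<Rightarrow> 'b" where
  "scaleR_fun c f = (\<lambda>x. c *\<^sub>R f x)"

instance
  by standard (simp_all add: scaleR_fun_def plus_fun_def fun_eq_iff algebra_simps)

end

section \<open>Quotients of real vector spaces\<close>

record 'v vspace =
  vcarrier :: "'v set"
  vadd :: "'v \<Rightarrow> 'v \<Rightarrow> 'v"
  vscale :: "real \<Rightarrow> 'v \<Rightarrow> 'v"

definition vspace_iso :: "'v vspace \<Rightarrow> 'w vspace \<Rightarrow> bool" where
  "vspace_iso V W \<longleftrightarrow> (\<exists>\<phi>. bij_betw \<phi> (vcarrier V) (vcarrier W) \<and>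
     (\<forall>x\<in>vcarrier V. \<forall>y\<in>vcarrier V. \<phi> (vadd V x y) = vadd W (\<phi> x) (\<phi> y)) \<and>
     (\<forall>c. \<forall>x\<in>vcarrier V. \<phi> (vscale V c x) = vscale W c (\<phi> x)))"

text \<open>
  The elements of the quotient of \<open>Z\<close> by a subspace \<open>B\<close> are the cosets \<open>z +o B\<close>.
  Adding \<open>B\<close> after scaling makes the scalar \<open>0\<close> yield the coset \<open>B\<close> and not \<open>{0}\<close>.
\<close>

definition quotient_vspace :: "'v::real_vector set \<Rightarrow> 'v set \<Rightarrow> 'v set vspace" where
  "quotient_vspace Z B =
     \<lparr>vcarrier = (\<lambda>z. z +o B) ` Z,
      vadd = (\<lambda>C D. C + D),
      vscale = (\<lambda>c C. (\<lambda>z. c *\<^sub>R z) ` C + B)\<rparr>"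

section \<open>Chevalley--Eilenberg cohomology with trivial real coefficients\<close>

text \<open>
  A Lie algebra is given by a subspace of an ambient real vector space together with a bracket.
\<close>

record 'v lie_algebra =
  lie_carrier :: "'v set"
  lie_bracket :: "'v \<Rightarrow> 'v \<Rightarrow> 'v"

text \<open>
  A \<open>k\<close>-cochain is an alternating \<open>k\<close>-linear form, represented as a function on lists
  which vanishes on all lists that are not \<open>k\<close>-tuples of elements of the Lie algebra.
\<close>

definition ce_cochains :: "'v::real_vector lie_algebra \<Rightarrow> nat \<Rightarrow> ('v list \<Rightarrow> real) set" where
  "ce_cochains L k = {f.
     (\<forall>xs. \<not> (length xs = k \<and> set xs \<subseteq> lie_carrier L) \<longrightarrow> f xs = 0) \<and>
     (\<forall>xs i a b. \<forall>u\<in>lie_carrier L. \<forall>v\<in>lie_carrier L.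
        length xs = k \<and> set xs \<subseteq> lie_carrier L \<and> i < k \<longrightarrow>
        f (xs[i := a *\<^sub>R u + b *\<^sub>R v]) = a * f (xs[i := u]) + b * f (xs[i := v])) \<and>
     (\<forall>xs. \<not> distinct xs \<longrightarrow> f xs = 0)}"

text \<open>
  \<open>d f(x\<^sub>0, \<dots>, x\<^sub>k) = \<Sum>\<^bsub>i<j\<^esub> (-1)\<^sup>i\<^sup>+\<^sup>j f([x\<^sub>i, x\<^sub>j], x\<^sub>0, \<dots>, x\<^sub>k)\<close>
  with the entries \<open>x\<^sub>i\<close> and \<open>x\<^sub>j\<close> omitted from the list \<open>x\<^sub>0, \<dots>, x\<^sub>k\<close>.
\<close>

definition ce_differential ::
    "'v::real_vector lie_algebra \<Rightarrow> nat \<Rightarrow> ('v list \<Rightarrow> real) \<Rightarrow> 'v list \<Rightarrow> real" where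
  "ce_differential L k f = (\<lambda>xs.
     if length xs = Suc k \<and> set xs \<subseteq> lie_carrier L
     then \<Sum>j<length xs. \<Sum>i<j.
       (-1) ^ (i + j) * f (lie_bracket L (xs ! i) (xs ! j) # nths xs (- {i, j}))
     else 0)"

definition ce_cocycles :: "'v::real_vector lie_algebra \<Rightarrow> nat \<Rightarrow> ('v list \<Rightarrow> real) set" where
  "ce_cocycles L k = {f \<in> ce_cochains L k. ce_differential L k f = 0}"

definition ce_coboundaries :: "'v::real_vector lie_algebra \<Rightarrow> nat \<Rightarrow> ('v list \<Rightarrow> real) set" where
  "ce_coboundaries L k =
     (case k of 0 \<Rightarrow> {0} | Suc m \<Rightarrow> ce_differential L m ` ce_cochains L m)"

definition ce_cohomology ::
    "'v::real_vector lie_algebra \<Rightarrow> nat \<Rightarrow> ('v list \<Rightarrow> real) set vspace" where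
  "ce_cohomology L k = quotient_vspace (ce_cocycles L k) (ce_coboundaries L k)"

section \<open>The Lie algebra of a graph with a collection of cliques\<close>

text \<open>
  \<open>XV i\<close>, \<open>XE i j\<close> and \<open>Y k\<close> stand for \<open>x\<^sub>i\<close>, \<open>x\<^bsub>i,j\<^esub>\<close> and \<open>y\<^sub>k\<close>. The collection of cliques
  is a list, so repetitions are allowed, and its members are indexed from \<open>0\<close>.
\<close>

datatype 'a gen = XV 'a | XE 'a 'a | Y nat

definition lie_gens :: "'a::linorder graph \<Rightarrow> 'a set list \<Rightarrow> 'a gen set" where
  "lie_gens G S = XV ` verts G \<union> {XE i j | i j. i < j \<and> {i, j} \<in> edges G} \<union> Y ` {..<length S}"

definition gen_vec :: "'a gen \<Rightarrow> 'a gen \<Rightarrow> real" where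
  "gen_vec b = (\<lambda>c. if c = b then 1 else 0)"

text \<open>
  The three defining rules for brackets of generators; all other values are zero.
  For \<open>b \<noteq> c\<close> at most one of the two orders \<open>(b, c)\<close> and \<open>(c, b)\<close> matches a rule, so
  subtracting the rule for the reversed pair below is exactly the skew-symmetric completion.
\<close>

fun bracket_rule :: "'a::linorder graph \<Rightarrow> 'a set list \<Rightarrow> 'a gen \<Rightarrow> 'a gen \<Rightarrow> 'a gen \<Rightarrow> real" where
  "bracket_rule G S (XV i) (XV j) = (if i < j \<and> {i, j} \<in> edges G then gen_vec (XE i j) else 0)"
| "bracket_rule G S (XV i) (Y k) = real (card ({i} \<inter> S ! k)) *\<^sub>R gen_vec (XV i)"
| "bracket_rule G S (XE i j) (Y k) = real (card ({i, j} \<inter> S ! k)) *\<^sub>R gen_vec (XE i j)"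
| "bracket_rule G S _ _ = 0"

definition graph_lie_algebra ::
    "'a::linorder graph \<Rightarrow> 'a set list \<Rightarrow> ('a gen \<Rightarrow> real) lie_algebra" where
  "graph_lie_algebra G S =
     \<lparr>lie_carrier = {x. \<forall>b. b \<notin> lie_gens G S \<longrightarrow> x b = 0},
      lie_bracket = (\<lambda>x y. \<Sum>b\<in>lie_gens G S. \<Sum>c\<in>lie_gens G S.
        (x b * y c) *\<^sub>R (bracket_rule G S b c - bracket_rule G S c b))\<rparr>"

end

theory Submission
  imports Defs "HOL-Library.FuncSet" "HOL-Library.Multiset"
begin

text \<open>
  The sum \<open>y\<close> of all \<open>y\<^sub>k\<close> acts diagonally on the generators: \<open>[y, b] = - w(b) b\<close>, where the weight
  \<open>w(b) \<ge> 0\<close> is additive under the bracket. The generators of weight zero are the \<open>y\<^sub>k\<close> and those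
  coming from the vertices and edges outside all cliques; they span a subalgebra isomorphic to the
  Lie algebra of the smaller graph, and the projection onto it along the span of the generators of
  positive weight is a homomorphism. Hence this subalgebra is a retract. By Cartan's formula
  contraction with \<open>y\<close> followed by division by the weight is a contracting homotopy on the cochains
  of nonzero weight, so every cocycle is cohomologous to its part of weight zero.
\<close>

section \<open>Sublists\<close>

text \<open>The isolated vertices arise because each \<open>y_k\<close> scales a generator, up to
  sign, by the number of its vertices in the \<open>k\<close>-th clique, and this number is zero on
  generators of weight zero. As the \<open>y_k\<close> also commute with each other, they are
  central in the weight-zero subalgebra, just as vertices without edges are.

  Nonnegativity of the weight is used twice. A bracket has weight zero only if both factors have, so
  the projection respects brackets; and a list of generators has weight zero only if each entry has,
  so pulling back along the projection is the same as keeping the weight-zero part of a cochain.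

  The obstacle is that cochains take arbitrary vectors, which mix weights, while the Lie derivative
  along \<open>y\<close> is diagonal only on lists of basis vectors. Weight components are therefore
  written through coordinates, and the homotopy identity is checked on basis lists and carried over
  by multilinearity.\<close>

lemma nths_list_update_notin: "i \<notin> A \<Longrightarrow> nths (xs[i := v]) A = nths xs A"
  by (induction xs arbitrary: i A) (auto simp: nths_Cons split: nat.split)

text \<open>The position \<open>j\<close> is fixed before \<open>v\<close>: it counts the selected
  indices below \<open>i\<close>. This uniformity lets linearity in one entry of a list pass to a
  sublist.\<close>

lemma nths_list_update_in:
  "i < length xs \<Longrightarrow> i \<in> A \<Longrightarrow>
    \<exists>j<length (nths xs A). \<forall>v. nths (xs[i := v]) A = (nths xs A)[j := v]"
proof (induction xs arbitrary: i A)
  case Nil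
  then show ?case by simp
next
  case (Cons x xs)
  show ?case
  proof (cases i)
    case 0
    with Cons.prems show ?thesis
      by (intro exI[of _ 0]) (auto simp: nths_Cons)
  next
    case (Suc n)
    with Cons.IH[of n "{j. Suc j \<in> A}"] Cons.prems obtain j where
      "j < length (nths xs {j. Suc j \<in> A})"
      "\<And>v. nths (xs[n := v]) {j. Suc j \<in> A} = (nths xs {j. Suc j \<in> A})[j := v]"
      by auto
    with Suc show ?thesis
      by (intro exI[of _ "if 0 \<in> A then Suc j else j"]) (auto simp: nths_Cons)
  qed
qed

lemma nths_Compl_singleton: "nths xs (- {j}) = take j xs @ drop (Suc j) xs"
proof (induction xs arbitrary: j)
  case (Cons x xs)
  have "{n. Suc n \<in> - {j}} = (case j of 0 \<Rightarrow> UNIV | Suc n \<Rightarrow> - {n})"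
    by (auto split: nat.splits)
  then show ?case
    using Cons.IH by (auto simp: nths_Cons nths_all split: nat.splits)
qed simp

lemma nths_Cons_Compl_0_Suc: "nths (x # xs) (- {0, Suc j}) = nths xs (- {j})"
  by (simp add: nths_Cons) (rule arg_cong[where f = "nths xs"], auto)

lemma nths_Cons_Compl_Suc_Suc: "nths (x # xs) (- {Suc i, Suc j}) = x # nths xs (- {i, j})"
  by (simp add: nths_Cons) (rule arg_cong[where f = "nths xs"], auto)

lemma length_nths_Compl_pair:
  assumes "i < j" "j < length xs"
  shows "length (nths xs (- {i, j})) = length xs - 2"
proof -
  have "{n. n < length xs \<and> n \<in> - {i, j}} = {..<length xs} - {i, j}" by auto
  with assms show ?thesis by (simp add: length_nths card_Diff_subset)
qed

text \<open>Bookkeeping for the differential: if weights add under the bracket, replacing two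
  entries by their bracket keeps the total weight of a list.\<close>

lemma sum_list_nths_Compl_pair:
  fixes w :: "'a \<Rightarrow> real"
  assumes "i < j" "j < length xs"
  shows "sum_list (map w xs) = w (xs ! i) + w (xs ! j) + sum_list (map w (nths xs (- {i, j})))"
proof -
  have split: "sum_list (map w xs) = sum_list (map w (nths xs A)) + sum_list (map w (nths xs (- A)))"
    for A
  proof (induction xs arbitrary: A)
    case (Cons x xs)
    have "{n. Suc n \<in> - A} = - {n. Suc n \<in> A}" by auto
    with Cons.IH[of "{n. Suc n \<in> A}"] show ?case by (auto simp: nths_Cons)
  qed simp
  have single: "nths xs {j} = [xs ! j]" if "j < length xs" for xs :: "'a list" and j
    using that
  proof (induction xs arbitrary: j)
    case (Cons x xs)
    have "{n. Suc n \<in> {j}} = (case j of 0 \<Rightarrow> {} | Suc n \<Rightarrow> {n})"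
      by (auto split: nat.splits)
    then show ?case using Cons by (auto simp: nths_Cons split: nat.splits)
  qed simp
  have "nths xs {i, j} = [xs ! i, xs ! j]"
    using assms
  proof (induction xs arbitrary: i j)
    case (Cons x xs)
    then obtain j' where j': "j = Suc j'" by (cases j) auto
    have "{n. Suc n \<in> {i, j}} = (case i of 0 \<Rightarrow> {j'} | Suc n \<Rightarrow> {n, j'})"
      using j' by (auto split: nat.splits)
    then show ?case using Cons j' by (auto simp: nths_Cons single split: nat.splits)
  qed simp
  with split[of "{i, j}"] show ?thesis by simp
qed

section \<open>Maps of quotients\<close>

lemma elt_set_plus_eq_iff:
  fixes B :: "'v::real_vector set"
  assumes "subspace B"
  shows "x +o B = y +o B \<longleftrightarrow> x - y \<in> B"
proof
  assume "x +o B = y +o B"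
  moreover have "x + 0 \<in> x +o B" using subspace_0[OF assms] by (rule set_plus_intro2)
  ultimately obtain b where "x = y + b" "b \<in> B" by (auto simp: elt_set_plus_def)
  then show "x - y \<in> B" by simp
next
  assume xy: "x - y \<in> B"
  show "x +o B = y +o B"
  proof (intro equalityI subsetI)
    fix z assume "z \<in> x +o B"
    then obtain b where "b \<in> B" "z = x + b" by (auto simp: elt_set_plus_def)
    then show "z \<in> y +o B"
      using subspace_add[OF assms xy \<open>b \<in> B\<close>]
      by (auto simp: elt_set_plus_def intro!: bexI[of _ "x - y + b"])
  next
    fix z assume "z \<in> y +o B"
    then obtain b where "b \<in> B" "z = y + b" by (auto simp: elt_set_plus_def)
    then show "z \<in> x +o B"
      using subspace_diff[OF assms \<open>b \<in> B\<close> xy]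
      by (auto simp: elt_set_plus_def intro!: bexI[of _ "b - (x - y)"])
  qed
qed

lemma coset_plus_coset:
  fixes B :: "'v::real_vector set"
  assumes "subspace B"
  shows "(x +o B) + (y +o B) = (x + y) +o B"
proof (intro equalityI subsetI)
  fix z assume "z \<in> (x +o B) + (y +o B)"
  then obtain b c where "b \<in> B" "c \<in> B" "z = (x + b) + (y + c)"
    by (auto simp: elt_set_plus_def set_plus_def)
  then show "z \<in> (x + y) +o B"
    using subspace_add[OF assms \<open>b \<in> B\<close> \<open>c \<in> B\<close>]
    by (auto simp: elt_set_plus_def intro!: bexI[of _ "b + c"])
next
  fix z assume "z \<in> (x + y) +o B"
  then obtain b where "b \<in> B" "z = (x + b) + (y + 0)"
    by (auto simp: elt_set_plus_def algebra_simps)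
  then show "z \<in> (x +o B) + (y +o B)"
    using subspace_0[OF assms] by (auto intro!: set_plus_intro set_plus_intro2 simp del: add_0_right)
qed

lemma scaled_coset:
  fixes B :: "'v::real_vector set"
  assumes "subspace B"
  shows "(\<lambda>z. c *\<^sub>R z) ` (x +o B) + B = (c *\<^sub>R x) +o B"
proof (intro equalityI subsetI)
  fix z assume "z \<in> (\<lambda>z. c *\<^sub>R z) ` (x +o B) + B"
  then obtain b b' where "b \<in> B" "b' \<in> B" "z = c *\<^sub>R (x + b) + b'"
    by (auto simp: elt_set_plus_def set_plus_def)
  then show "z \<in> (c *\<^sub>R x) +o B"
    using subspace_add[OF assms subspace_scale[OF assms \<open>b \<in> B\<close>, of c] \<open>b' \<in> B\<close>]
    by (auto simp: elt_set_plus_def algebra_simps intro!: bexI[of _ "c *\<^sub>R b + b'"])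
next
  fix z assume "z \<in> (c *\<^sub>R x) +o B"
  then obtain b where "b \<in> B" "z = c *\<^sub>R (x + 0) + b"
    by (auto simp: elt_set_plus_def)
  then show "z \<in> (\<lambda>z. c *\<^sub>R z) ` (x +o B) + B"
    using subspace_0[OF assms]
    by (auto intro!: set_plus_intro set_plus_intro2 imageI simp del: add_0_right)
qed

text \<open>\<open>T\<close> may map \<open>B\<close> onto a proper part of \<open>B'\<close>, so
  the image of a coset need not be a coset; adding \<open>B'\<close> completes it.\<close>

lemma image_coset_plus:
  assumes "linear T" "subspace B" "subspace B'" "T ` B \<subseteq> B'"
  shows "T ` (x +o B) + B' = T x +o B'"
proof (intro equalityI subsetI)
  fix z assume "z \<in> T ` (x +o B) + B'"
  then obtain b b' where bb: "b \<in> B" "b' \<in> B'" "z = T (x + b) + b'"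
    by (auto simp: elt_set_plus_def set_plus_def)
  have "T b + b' \<in> B'" using bb assms by (auto intro!: subspace_add)
  with bb show "z \<in> T x +o B'"
    by (auto simp: elt_set_plus_def linear_add[OF assms(1)] add.assoc)
next
  fix z assume "z \<in> T x +o B'"
  then obtain b where "b \<in> B'" "z = T (x + 0) + b"
    by (auto simp: elt_set_plus_def)
  then show "z \<in> T ` (x +o B) + B'"
    using subspace_0[OF assms(2)]
    by (auto intro!: set_plus_intro set_plus_intro2 imageI simp del: add_0_right)
qed

text \<open>Surjectivity is asked of \<open>T\<close> on \<open>Z\<close> itself rather than modulo
  \<open>B'\<close>. This suits restriction to a retract, where every cocycle extends.\<close>

lemma vspace_iso_quotient:
  fixes Z B :: "'v::real_vector set" and Z' B' :: "'w::real_vector set"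
  assumes T: "linear T" and B: "subspace B" and B': "subspace B'"
    and Z: "\<And>x y. x \<in> Z \<Longrightarrow> y \<in> Z \<Longrightarrow> x - y \<in> Z"
    and maps: "T ` Z \<subseteq> Z'" "T ` B \<subseteq> B'"
    and inj: "\<And>z. z \<in> Z \<Longrightarrow> T z \<in> B' \<Longrightarrow> z \<in> B"
    and surj: "\<And>z'. z' \<in> Z' \<Longrightarrow> \<exists>z\<in>Z. T z = z'"
  shows "vspace_iso (quotient_vspace Z B) (quotient_vspace Z' B')"
proof -
  define \<Phi> where "\<Phi> C = T ` C + B'" for C
  have \<Phi>: "\<Phi> (z +o B) = T z +o B'" for z
    unfolding \<Phi>_def by (rule image_coset_plus[OF T B B' maps(2)])
  have Tdiff: "T (x - y) = T x - T y" for x y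
    using T by (rule linear_diff)
  have "inj_on \<Phi> ((\<lambda>z. z +o B) ` Z)"
  proof (rule inj_onI, clarify)
    fix x y assume "x \<in> Z" "y \<in> Z" "\<Phi> (x +o B) = \<Phi> (y +o B)"
    then show "x +o B = y +o B"
      using inj[of "x - y"] Z[of x y] by (simp add: \<Phi> elt_set_plus_eq_iff[OF B'] elt_set_plus_eq_iff[OF B] Tdiff)
  qed
  moreover have "\<Phi> ` (\<lambda>z. z +o B) ` Z = (\<lambda>z. z +o B') ` Z'"
    using maps(1) surj by (fastforce simp: image_image \<Phi>)
  ultimately have "bij_betw \<Phi> ((\<lambda>z. z +o B) ` Z) ((\<lambda>z. z +o B') ` Z')"
    by (simp add: bij_betw_def)
  moreover have "\<Phi> ((x +o B) + (y +o B)) = \<Phi> (x +o B) + \<Phi> (y +o B)" for x y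
    by (simp add: coset_plus_coset B B' \<Phi> linear_add[OF T])
  moreover have "\<Phi> ((\<lambda>z. c *\<^sub>R z) ` (x +o B) + B) = (\<lambda>z. c *\<^sub>R z) ` \<Phi> (x +o B) + B'" for c x
    by (simp add: scaled_coset B B' \<Phi> linear_scale[OF T])
  ultimately show ?thesis
    unfolding vspace_iso_def quotient_vspace_def by (intro exI[of _ \<Phi>]) auto
qed

section \<open>Multilinear forms and cochains\<close>

text \<open>Linearity in each entry is split off from alternation because it alone determines a form
  by its values on basis lists, the test by which a primitive is recognised later.\<close>

definition multilinear_forms :: "'v::real_vector lie_algebra \<Rightarrow> nat \<Rightarrow> ('v list \<Rightarrow> real) set" where
  "multilinear_forms L k = {f.
     (\<forall>xs. \<not> (length xs = k \<and> set xs \<subseteq> lie_carrier L) \<longrightarrow> f xs = 0) \<and>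
     (\<forall>xs i a b. \<forall>u\<in>lie_carrier L. \<forall>v\<in>lie_carrier L.
        length xs = k \<and> set xs \<subseteq> lie_carrier L \<and> i < k \<longrightarrow>
        f (xs[i := a *\<^sub>R u + b *\<^sub>R v]) = a * f (xs[i := u]) + b * f (xs[i := v]))}"

lemma ce_cochains_iff:
  "f \<in> ce_cochains L k \<longleftrightarrow> f \<in> multilinear_forms L k \<and> (\<forall>xs. \<not> distinct xs \<longrightarrow> f xs = 0)"
  unfolding ce_cochains_def multilinear_forms_def by blast

lemma multilinear_formsI:
  assumes "\<And>xs. \<not> (length xs = k \<and> set xs \<subseteq> lie_carrier L) \<Longrightarrow> f xs = 0"
    and "\<And>xs i a b u v. u \<in> lie_carrier L \<Longrightarrow> v \<in> lie_carrier L \<Longrightarrow> length xs = k \<Longrightarrow>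
      set xs \<subseteq> lie_carrier L \<Longrightarrow> i < k \<Longrightarrow>
      f (xs[i := a *\<^sub>R u + b *\<^sub>R v]) = a * f (xs[i := u]) + b * f (xs[i := v])"
  shows "f \<in> multilinear_forms L k"
  using assms unfolding multilinear_forms_def by blast

lemma multilinear_forms_outside:
  "f \<in> multilinear_forms L k \<Longrightarrow> \<not> (length xs = k \<and> set xs \<subseteq> lie_carrier L) \<Longrightarrow> f xs = 0"
  unfolding multilinear_forms_def by blast

lemma multilinear_forms_update:
  "f \<in> multilinear_forms L k \<Longrightarrow> u \<in> lie_carrier L \<Longrightarrow> v \<in> lie_carrier L \<Longrightarrow> length xs = k \<Longrightarrow>
    set xs \<subseteq> lie_carrier L \<Longrightarrow> i < k \<Longrightarrow>
    f (xs[i := a *\<^sub>R u + b *\<^sub>R v]) = a * f (xs[i := u]) + b * f (xs[i := v])"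
  unfolding multilinear_forms_def by blast

lemma subspace_multilinear_forms: "subspace (multilinear_forms L k)"
proof (rule subspaceI)
  show "0 \<in> multilinear_forms L k" by (rule multilinear_formsI) auto
next
  fix f g assume f: "f \<in> multilinear_forms L k" and g: "g \<in> multilinear_forms L k"
  show "f + g \<in> multilinear_forms L k"
  proof (rule multilinear_formsI)
    fix xs i a b u v
    assume *: "u \<in> lie_carrier L" "v \<in> lie_carrier L" "length xs = k" "set xs \<subseteq> lie_carrier L" "i < k"
    show "(f + g) (xs[i := a *\<^sub>R u + b *\<^sub>R v]) = a * (f + g) (xs[i := u]) + b * (f + g) (xs[i := v])"
      using multilinear_forms_update[OF f *] multilinear_forms_update[OF g *]
      by (simp add: algebra_simps)
  qed (use multilinear_forms_outside[OF f] multilinear_forms_outside[OF g] in auto)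
next
  fix c f assume f: "f \<in> multilinear_forms L k"
  show "c *\<^sub>R f \<in> multilinear_forms L k"
  proof (rule multilinear_formsI)
    fix xs i a b u v
    assume *: "u \<in> lie_carrier L" "v \<in> lie_carrier L" "length xs = k" "set xs \<subseteq> lie_carrier L" "i < k"
    show "(c *\<^sub>R f) (xs[i := a *\<^sub>R u + b *\<^sub>R v]) = a * (c *\<^sub>R f) (xs[i := u]) + b * (c *\<^sub>R f) (xs[i := v])"
      using multilinear_forms_update[OF f *] by (simp add: scaleR_fun_def algebra_simps)
  qed (use multilinear_forms_outside[OF f] in \<open>auto simp: scaleR_fun_def\<close>)
qed

lemma subspace_ce_cochains:
  fixes L :: "'v::real_vector lie_algebra"
  shows "subspace (ce_cochains L k)"
proof -
  have "ce_cochains L k = multilinear_forms L k \<inter> {f. \<forall>xs. \<not> distinct xs \<longrightarrow> f xs = 0}"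
    by (auto simp: ce_cochains_iff)
  moreover have "subspace {f :: 'v list \<Rightarrow> real. \<forall>xs. \<not> distinct xs \<longrightarrow> f xs = 0}"
    by (rule subspaceI) (auto simp: scaleR_fun_def)
  ultimately show ?thesis
    using subspace_inter[OF subspace_multilinear_forms] by simp
qed

lemma linear_ce_differential: "linear (ce_differential L k)"
  by (rule linearI)
    (auto simp: ce_differential_def scaleR_fun_def fun_eq_iff algebra_simps sum.distrib sum_distrib_left)

lemma subspace_ce_coboundaries: "subspace (ce_coboundaries L k)"
  by (cases k) (auto simp: ce_coboundaries_def subspace_ce_cochains
      intro!: linear_subspace_image linear_ce_differential subspace_single_0)

lemma ce_cocycles_diff:
  assumes "f \<in> ce_cocycles L k" "g \<in> ce_cocycles L k"
  shows "f - g \<in> ce_cocycles L k"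
  using assms
  by (simp add: ce_cocycles_def linear_diff[OF linear_ce_differential] subspace_diff[OF subspace_ce_cochains])

lemma multilinear_forms_sum:
  assumes f: "f \<in> multilinear_forms L k" and L: "subspace (lie_carrier L)"
    and xs: "length xs = k" "set xs \<subseteq> lie_carrier L" "i < k"
    and "finite A" "\<And>x. x \<in> A \<Longrightarrow> u x \<in> lie_carrier L"
  shows "f (xs[i := \<Sum>x\<in>A. c x *\<^sub>R u x]) = (\<Sum>x\<in>A. c x * f (xs[i := u x]))"
  using assms(6,7)
proof (induction A)
  case empty
  show ?case
    using multilinear_forms_update[OF f _ _ xs, of 0 0 0 0] subspace_0[OF L] by simp
next
  case (insert x A)
  have "(\<Sum>x\<in>A. c x *\<^sub>R u x) \<in> lie_carrier L"
    using insert.prems by (intro subspace_sum[OF L] subspace_scale[OF L]) auto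
  then have "f (xs[i := c x *\<^sub>R u x + 1 *\<^sub>R (\<Sum>x\<in>A. c x *\<^sub>R u x)]) =
      c x * f (xs[i := u x]) + 1 * f (xs[i := \<Sum>x\<in>A. c x *\<^sub>R u x])"
    using insert.prems by (intro multilinear_forms_update[OF f _ _ xs]) auto
  with insert show ?case by simp
qed

lemma set_update_subset: "set xs \<subseteq> A \<Longrightarrow> u \<in> A \<Longrightarrow> set (xs[i := u]) \<subseteq> A"
  using set_update_subset_insert[of xs i u] by blast

text \<open>Polarisation: the form with \<open>u + v\<close> in both places vanishes, and so do the
  two diagonal terms of its expansion.\<close>

lemma ce_cochains_swap:
  assumes f: "f \<in> ce_cochains L k" and L: "subspace (lie_carrier L)"
    and xs: "length xs = k" "set xs \<subseteq> lie_carrier L"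
    and ij: "i < k" "j < k" "i \<noteq> j"
    and u: "u \<in> lie_carrier L" and v: "v \<in> lie_carrier L"
  shows "f (xs[i := u, j := v]) = - f (xs[i := v, j := u])"
proof -
  have m: "f \<in> multilinear_forms L k" using f by (simp add: ce_cochains_iff)
  define g where "g a b = f (xs[i := a, j := b])" for a b
  have diag: "g a a = 0" for a
  proof -
    have "\<not> distinct (xs[i := a, j := a])"
      using xs ij unfolding distinct_conv_nth by (auto simp: nth_list_update)
    then show ?thesis using f by (simp add: g_def ce_cochains_iff)
  qed
  have right: "g a (u + v) = g a u + g a v" if "a \<in> lie_carrier L" for a
    using multilinear_forms_update[OF m u v, of "xs[i := a]" j 1 1] xs ij that
    by (simp add: g_def set_update_subset)
  have left: "g (u + v) a = g u a + g v a" if "a \<in> lie_carrier L" for a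
    using multilinear_forms_update[OF m u v, of "xs[j := a]" i 1 1] xs ij that
    by (simp add: g_def set_update_subset list_update_swap)
  have "g (u + v) (u + v) = g u u + g u v + (g v u + g v v)"
    using left[of "u + v"] right u v subspace_add[OF L u v] by simp
  then show ?thesis by (simp add: diag g_def)
qed

text \<open>One transposition for each entry passed. It carries a bracket from the head of a list
  past the entries that should precede it.\<close>

lemma ce_cochains_move:
  assumes f: "f \<in> ce_cochains L k" and L: "subspace (lie_carrier L)"
    and "length (ps @ z # us @ vs) = k" "set (ps @ z # us @ vs) \<subseteq> lie_carrier L"
  shows "f (ps @ z # us @ vs) = (- 1) ^ length us * f (ps @ us @ z # vs)"
  using assms(3,4)
proof (induction us arbitrary: ps)
  case (Cons u us)
  let ?l = "length ps"
  have "f (ps @ z # u # us @ vs) = - f (ps @ u # z # us @ vs)"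
    using ce_cochains_swap[OF f L, of "ps @ z # u # us @ vs" ?l "Suc ?l" z u] Cons.prems
    by (simp add: list_update_append)
  also have "f (ps @ u # z # us @ vs) = (- 1) ^ length us * f (ps @ u # us @ z # vs)"
    using Cons.IH[of "ps @ [u]"] Cons.prems by simp
  finally show ?case by simp
qed simp

definition bracket_closed :: "'v lie_algebra \<Rightarrow> bool" where
  "bracket_closed L \<longleftrightarrow> (\<forall>x\<in>lie_carrier L. \<forall>y\<in>lie_carrier L. lie_bracket L x y \<in> lie_carrier L)"

lemma bracket_closedD:
  "bracket_closed L \<Longrightarrow> x \<in> lie_carrier L \<Longrightarrow> y \<in> lie_carrier L \<Longrightarrow> lie_bracket L x y \<in> lie_carrier L"
  by (simp add: bracket_closed_def)

text \<open>In each term the entry \<open>m\<close> occurs once: inside the bracket if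
  \<open>m\<close> is one of the two chosen indices, and in the remaining sublist otherwise.\<close>

lemma multilinear_ce_differential:
  assumes g: "g \<in> multilinear_forms L k" and L: "subspace (lie_carrier L)"
    and closed: "bracket_closed L"
    and left: "\<And>a b x y z. lie_bracket L (a *\<^sub>R x + b *\<^sub>R y) z = a *\<^sub>R lie_bracket L x z + b *\<^sub>R lie_bracket L y z"
    and right: "\<And>a b x y z. lie_bracket L z (a *\<^sub>R x + b *\<^sub>R y) = a *\<^sub>R lie_bracket L z x + b *\<^sub>R lie_bracket L z y"
  shows "ce_differential L k g \<in> multilinear_forms L (Suc k)"
proof (rule multilinear_formsI)
  fix xs m a b u v
  assume u: "u \<in> lie_carrier L" and v: "v \<in> lie_carrier L" and len: "length xs = Suc k"
    and xs: "set xs \<subseteq> lie_carrier L" and m: "m < Suc k"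
  define t where "t i j xs = g (lie_bracket L (xs ! i) (xs ! j) # nths xs (- {i, j}))" for i j xs
  have t: "t i j (xs[m := a *\<^sub>R u + b *\<^sub>R v]) = a * t i j (xs[m := u]) + b * t i j (xs[m := v])"
    if ij: "i < j" "j < Suc k" for i j
  proof -
    have rest: "length (nths xs (- {i, j})) = k - 1" "k > 0"
      using length_nths_Compl_pair[of i j xs] ij len by auto
    have nin: "nth xs n \<in> lie_carrier L" if "n < Suc k" for n
      using that xs len by auto
    have rest_set: "set (nths xs (- {i, j})) \<subseteq> lie_carrier L"
      by (rule subset_trans[OF set_nths_subset xs])
    show ?thesis
    proof (cases "m \<in> {i, j}")
      case True
      then have same: "nths (xs[m := w]) (- {i, j}) = nths xs (- {i, j})" for w
        by (intro nths_list_update_notin) auto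
      have br: "lie_bracket L (xs[m := a *\<^sub>R u + b *\<^sub>R v] ! i) (xs[m := a *\<^sub>R u + b *\<^sub>R v] ! j) =
          a *\<^sub>R lie_bracket L (xs[m := u] ! i) (xs[m := u] ! j) +
          b *\<^sub>R lie_bracket L (xs[m := v] ! i) (xs[m := v] ! j)"
        using True ij len m by (auto simp: nth_list_update left right)
      have "lie_bracket L (xs[m := w] ! i) (xs[m := w] ! j) \<in> lie_carrier L"
        if "w \<in> lie_carrier L" for w
        using that ij len m nin by (auto intro!: bracket_closedD[OF closed] simp: nth_list_update)
      \<comment> \<open>The head \<open>0\<close> is a placeholder: the update at position
        \<open>0\<close> overwrites it with the bracket.\<close>
      then show ?thesis
        using multilinear_forms_update[OF g, of _ _ "0 # nths xs (- {i, j})" 0 a b]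
          u v rest rest_set subspace_0[OF L]
        by (simp add: t_def same br)
    next
      case False
      then obtain n where n: "n < length (nths xs (- {i, j}))"
        "\<And>w. nths (xs[m := w]) (- {i, j}) = (nths xs (- {i, j}))[n := w]"
        using nths_list_update_in[of m xs "- {i, j}"] m len by auto
      let ?z = "lie_bracket L (xs ! i) (xs ! j)"
      have br: "lie_bracket L (xs[m := w] ! i) (xs[m := w] ! j) = ?z" for w
        using False by simp
      have "?z \<in> lie_carrier L" using ij nin by (intro bracket_closedD[OF closed]) auto
      then show ?thesis
        using multilinear_forms_update[OF g u v, of "?z # nths xs (- {i, j})" "Suc n" a b] rest rest_set n(1)
        by (simp add: t_def n(2) br)
    qed
  qed
  have d: "ce_differential L k g (xs[m := w]) = (\<Sum>j<Suc k. \<Sum>i<j. (- 1) ^ (i + j) * t i j (xs[m := w]))"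
    if "w \<in> lie_carrier L" for w
    using set_update_subset[OF xs that] len by (simp add: ce_differential_def t_def)
  have "a *\<^sub>R u + b *\<^sub>R v \<in> lie_carrier L"
    by (intro subspace_add[OF L] subspace_scale[OF L] u v)
  note d_uv = d[OF this]
  have "ce_differential L k g (xs[m := a *\<^sub>R u + b *\<^sub>R v]) =
      (\<Sum>j<Suc k. \<Sum>i<j. a * ((- 1) ^ (i + j) * t i j (xs[m := u])) + b * ((- 1) ^ (i + j) * t i j (xs[m := v])))"
    unfolding d_uv by (intro sum.cong refl) (simp add: t distrib_left mult.left_commute)
  also have "\<dots> = a * ce_differential L k g (xs[m := u]) + b * ce_differential L k g (xs[m := v])"
    unfolding d[OF u] d[OF v] by (simp only: sum.distrib sum_distrib_left)
  finally show "ce_differential L k g (xs[m := a *\<^sub>R u + b *\<^sub>R v]) =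
      a * ce_differential L k g (xs[m := u]) + b * ce_differential L k g (xs[m := v])" .
qed (auto simp: ce_differential_def)

section \<open>Pullbacks along homomorphisms\<close>

definition lie_hom :: "'v::real_vector lie_algebra \<Rightarrow> 'w::real_vector lie_algebra \<Rightarrow> ('v \<Rightarrow> 'w) \<Rightarrow> bool" where
  "lie_hom L M h \<longleftrightarrow> linear h \<and> h ` lie_carrier L \<subseteq> lie_carrier M \<and>
     (\<forall>x\<in>lie_carrier L. \<forall>y\<in>lie_carrier L. h (lie_bracket L x y) = lie_bracket M (h x) (h y))"

text \<open>The guard keeps the pullback zero on lists that leave the carrier of \<open>L\<close>.\<close>

definition pullback :: "'v::real_vector lie_algebra \<Rightarrow> ('v \<Rightarrow> 'w) \<Rightarrow> ('w list \<Rightarrow> real) \<Rightarrow> 'v list \<Rightarrow> real" where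
  "pullback L h f = (\<lambda>xs. if set xs \<subseteq> lie_carrier L then f (map h xs) else 0)"

lemma linear_pullback: "linear (pullback L h)"
  by (rule linearI) (auto simp: pullback_def scaleR_fun_def fun_eq_iff)

lemma pullback_ce_cochains:
  assumes h: "lie_hom L M h" and L: "subspace (lie_carrier L)" and f: "f \<in> ce_cochains M k"
  shows "pullback L h f \<in> ce_cochains L k"
  unfolding ce_cochains_iff
proof (intro conjI allI impI)
  have m: "f \<in> multilinear_forms M k" using f by (simp add: ce_cochains_iff)
  have lin: "linear h" and hc: "\<And>x. x \<in> lie_carrier L \<Longrightarrow> h x \<in> lie_carrier M"
    using h by (auto simp: lie_hom_def)
  show "pullback L h f \<in> multilinear_forms L k"
  proof (rule multilinear_formsI)
    fix xs assume "\<not> (length xs = k \<and> set xs \<subseteq> lie_carrier L)"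
    then show "pullback L h f xs = 0"
      using multilinear_forms_outside[OF m, of "map h xs"] by (auto simp: pullback_def)
  next
    fix xs i a b u v
    assume *: "u \<in> lie_carrier L" "v \<in> lie_carrier L" "length xs = k" "set xs \<subseteq> lie_carrier L" "i < k"
    have "a *\<^sub>R u + b *\<^sub>R v \<in> lie_carrier L"
      by (intro subspace_add[OF L] subspace_scale[OF L] *)
    then show "pullback L h f (xs[i := a *\<^sub>R u + b *\<^sub>R v]) =
        a * pullback L h f (xs[i := u]) + b * pullback L h f (xs[i := v])"
      using * multilinear_forms_update[OF m hc[OF *(1)] hc[OF *(2)], of "map h xs" i a b] hc
      by (simp add: pullback_def set_update_subset map_update linear_add[OF lin] linear_scale[OF lin]
          image_subsetI subsetD[OF *(4)])
  qed
next
  fix xs :: "'a list" assume "\<not> distinct xs"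
  then show "pullback L h f xs = 0"
    using f by (auto simp: pullback_def ce_cochains_iff distinct_map)
qed

text \<open>Omitting entries commutes with \<open>map h\<close>, so the terms agree one by one.
  Closure of \<open>L\<close> under the bracket keeps the shortened list within the guard of
  \<open>pullback\<close>.\<close>

lemma ce_differential_pullback:
  assumes h: "lie_hom L M h" and closed: "bracket_closed L"
  shows "ce_differential L k (pullback L h f) = pullback L h (ce_differential M k f)"
proof
  fix xs
  have hM: "h ` lie_carrier L \<subseteq> lie_carrier M"
    and hb: "\<And>x y. x \<in> lie_carrier L \<Longrightarrow> y \<in> lie_carrier L \<Longrightarrow> h (lie_bracket L x y) = lie_bracket M (h x) (h y)"
    using h by (auto simp: lie_hom_def)
  show "ce_differential L k (pullback L h f) xs = pullback L h (ce_differential M k f) xs"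
  proof (cases "length xs = Suc k \<and> set xs \<subseteq> lie_carrier L")
    case True
    then have in_M: "set (map h xs) \<subseteq> lie_carrier M" using hM by auto
    have eq: "pullback L h f (lie_bracket L (xs ! i) (xs ! j) # nths xs (- {i, j})) =
        f (lie_bracket M (map h xs ! i) (map h xs ! j) # nths (map h xs) (- {i, j}))"
      if "i < j" "j < length xs" for i j
    proof -
      have c: "xs ! i \<in> lie_carrier L" "xs ! j \<in> lie_carrier L"
        using True that nth_mem[of i xs] nth_mem[of j xs] by (auto simp del: nth_mem)
      have "set (nths xs (- {i, j})) \<subseteq> lie_carrier L"
        using True by (intro subset_trans[OF set_nths_subset]) simp
      then show ?thesis
        using that by (simp add: pullback_def nths_map hb c bracket_closedD[OF closed])
    qed
    have "ce_differential L k (pullback L h f) xs = ce_differential M k f (map h xs)"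
      using True in_M unfolding ce_differential_def
      by (simp only: length_map simp_thms if_True) (intro sum.cong refl arg_cong2[where f = "(*)"] eq; simp)
    then show ?thesis using True by (simp add: pullback_def)
  qed (auto simp: ce_differential_def pullback_def)
qed

lemma pullback_ce_cocycles:
  assumes h: "lie_hom L M h" and L: "subspace (lie_carrier L)"
    and closed: "bracket_closed L"
    and f: "f \<in> ce_cocycles M k"
  shows "pullback L h f \<in> ce_cocycles L k"
  using f pullback_ce_cochains[OF h L, of f k]
  by (simp add: ce_cocycles_def ce_differential_pullback[OF h closed] linear_0[OF linear_pullback])

lemma pullback_ce_coboundaries:
  assumes h: "lie_hom L M h" and L: "subspace (lie_carrier L)"
    and closed: "bracket_closed L"
    and f: "f \<in> ce_coboundaries M k"
  shows "pullback L h f \<in> ce_coboundaries L k"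
proof (cases k)
  case 0
  then show ?thesis using f by (simp add: ce_coboundaries_def linear_0[OF linear_pullback])
next
  case (Suc m)
  then obtain g where "g \<in> ce_cochains M m" "f = ce_differential M m g"
    using f by (auto simp: ce_coboundaries_def)
  then show ?thesis
    using Suc pullback_ce_cochains[OF h L] ce_differential_pullback[OF h closed, of m g]
    by (auto simp: ce_coboundaries_def intro!: image_eqI[of _ _ "pullback L h g"])
qed

text \<open>Restriction along \<open>i\<close> is the isomorphism. It is injective on cohomology
  because, by \<open>homotopy\<close>, \<open>f\<close> differs by a coboundary from the pullback
  along \<open>r\<close> of its restriction; it is surjective because pulling back along
  \<open>r\<close> extends every cocycle of \<open>M\<close>.\<close>

lemma vspace_iso_ce_cohomology_retract:
  assumes i: "lie_hom M L i" and r: "lie_hom L M r"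
    and ri: "\<And>x. x \<in> lie_carrier M \<Longrightarrow> r (i x) = x"
    and L: "subspace (lie_carrier L)" and M: "subspace (lie_carrier M)"
    and closedL: "bracket_closed L"
    and closedM: "bracket_closed M"
    and homotopy: "\<And>f. f \<in> ce_cocycles L k \<Longrightarrow> f - pullback L (i \<circ> r) f \<in> ce_coboundaries L k"
  shows "vspace_iso (ce_cohomology L k) (ce_cohomology M k)"
  unfolding ce_cohomology_def
proof (rule vspace_iso_quotient[where T = "pullback M i"])
  show "pullback M i ` ce_cocycles L k \<subseteq> ce_cocycles M k"
    using pullback_ce_cocycles[OF i M closedM] by auto
  show "pullback M i ` ce_coboundaries L k \<subseteq> ce_coboundaries M k"
    using pullback_ce_coboundaries[OF i M closedM] by auto
next
  fix f assume f: "f \<in> ce_cocycles L k" "pullback M i f \<in> ce_coboundaries M k"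
  have "pullback L r (pullback M i f) \<in> ce_coboundaries L k"
    using f(2) by (rule pullback_ce_coboundaries[OF r L closedL])
  moreover have "pullback L r (pullback M i f) = pullback L (i \<circ> r) f"
    using r unfolding pullback_def fun_eq_iff lie_hom_def by (auto simp: image_subset_iff subset_iff)
  ultimately show "f \<in> ce_coboundaries L k"
    using subspace_add[OF subspace_ce_coboundaries homotopy[OF f(1)]] by fastforce
next
  fix g assume g: "g \<in> ce_cocycles M k"
  have "pullback M i (pullback L r g) = g"
  proof
    fix xs
    show "pullback M i (pullback L r g) xs = g xs"
    proof (cases "set xs \<subseteq> lie_carrier M")
      case True
      then have "map (r \<circ> i) xs = xs" using ri by (auto intro!: map_idI)
      then show ?thesis using True i by (auto simp: pullback_def lie_hom_def)
    next
      case False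
      then show ?thesis using g by (auto simp: pullback_def ce_cocycles_def ce_cochains_def)
    qed
  qed
  then show "\<exists>f\<in>ce_cocycles L k. pullback M i f = g"
    using pullback_ce_cocycles[OF r L closedL g] by blast
qed (auto intro: linear_pullback subspace_ce_coboundaries ce_cocycles_diff)

section \<open>Lie algebras with a weighted basis\<close>

lemma sum_fun_apply: "(\<Sum>a\<in>A. f a) x = (\<Sum>a\<in>A. f a x)"
  by (induction A rule: infinite_finite_induct) auto

definition basis_vec :: "'g \<Rightarrow> 'g \<Rightarrow> real" where
  "basis_vec b = (\<lambda>c. if c = b then 1 else 0)"

text \<open>The numbers \<open>K b c a\<close> are the structure constants. The type of generators
  is left arbitrary so that algebras over different generator types can be compared.\<close>

definition based_lie_algebra :: "'g set \<Rightarrow> ('g \<Rightarrow> 'g \<Rightarrow> 'g \<Rightarrow> real) \<Rightarrow> ('g \<Rightarrow> real) lie_algebra" where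
  "based_lie_algebra B K =
     \<lparr>lie_carrier = {x. \<forall>b. b \<notin> B \<longrightarrow> x b = 0},
      lie_bracket = (\<lambda>x y. \<Sum>b\<in>B. \<Sum>c\<in>B. (x b * y c) *\<^sub>R K b c)\<rparr>"

lemma based_lie_bracket_apply:
  "lie_bracket (based_lie_algebra B K) x y a = (\<Sum>b\<in>B. \<Sum>c\<in>B. x b * y c * K b c a)"
  by (simp add: based_lie_algebra_def sum_fun_apply scaleR_fun_def)

lemma based_lie_carrier_iff: "x \<in> lie_carrier (based_lie_algebra B K) \<longleftrightarrow> (\<forall>b. b \<notin> B \<longrightarrow> x b = 0)"
  by (simp add: based_lie_algebra_def)

lemma subspace_based_lie_carrier: "subspace (lie_carrier (based_lie_algebra B K))"
  by (rule subspaceI) (auto simp: based_lie_carrier_iff scaleR_fun_def)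

lemma based_lie_bracket_left:
  "lie_bracket (based_lie_algebra B K) (a *\<^sub>R x + b *\<^sub>R y) z =
    a *\<^sub>R lie_bracket (based_lie_algebra B K) x z + b *\<^sub>R lie_bracket (based_lie_algebra B K) y z"
  by (rule ext)
    (simp add: based_lie_bracket_apply scaleR_fun_def sum_distrib_left sum.distrib distrib_left distrib_right mult.assoc)

lemma based_lie_bracket_right:
  "lie_bracket (based_lie_algebra B K) z (a *\<^sub>R x + b *\<^sub>R y) =
    a *\<^sub>R lie_bracket (based_lie_algebra B K) z x + b *\<^sub>R lie_bracket (based_lie_algebra B K) z y"
  by (rule ext)
    (simp add: based_lie_bracket_apply scaleR_fun_def sum_distrib_left sum.distrib distrib_left distrib_right
      mult.assoc mult.left_commute)

lemma bracket_closed_based: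
  assumes "\<And>b c a. b \<in> B \<Longrightarrow> c \<in> B \<Longrightarrow> a \<notin> B \<Longrightarrow> K b c a = 0"
  shows "bracket_closed (based_lie_algebra B K)"
  using assms by (auto simp: bracket_closed_def based_lie_carrier_iff based_lie_bracket_apply intro!: sum.neutral)

text \<open>\<open>y\<close> is a grading element: in coordinates, \<open>y_acts\<close> says that
  bracketing with \<open>y\<close> on the left multiplies \<open>b\<close> by \<open>- w b\<close>.
  The sign comes from the convention that clique generators stand on the right in the defining
  rules.\<close>

locale weighted_lie_algebra =
  fixes B :: "'g set" and K :: "'g \<Rightarrow> 'g \<Rightarrow> 'g \<Rightarrow> real" and w :: "'g \<Rightarrow> real" and y :: "'g \<Rightarrow> real"
  assumes finite_B: "finite B"
    and K_closed: "b \<in> B \<Longrightarrow> c \<in> B \<Longrightarrow> K b c a \<noteq> 0 \<Longrightarrow> a \<in> B"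
    and K_weight: "b \<in> B \<Longrightarrow> c \<in> B \<Longrightarrow> K b c a \<noteq> 0 \<Longrightarrow> w a = w b + w c"
    and w_nonneg: "b \<in> B \<Longrightarrow> 0 \<le> w b"
    and y_in: "b \<notin> B \<Longrightarrow> y b = 0"
    and y_acts: "b \<in> B \<Longrightarrow> (\<Sum>c\<in>B. y c * K c b a) = (if a = b then - w b else 0)"
begin

abbreviation L where "L \<equiv> based_lie_algebra B K"

abbreviation weight :: "'g list \<Rightarrow> real" where "weight bs \<equiv> sum_list (map w bs)"

lemma y_in_L: "y \<in> lie_carrier L"
  by (simp add: based_lie_carrier_iff y_in)

section \<open>Multilinear forms on lists of basis vectors\<close>

lemma basis_vec_in: "b \<in> B \<Longrightarrow> basis_vec b \<in> lie_carrier L"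
  by (auto simp: based_lie_carrier_iff basis_vec_def)

lemma basis_vecs_in: "set bs \<subseteq> B \<Longrightarrow> set (map basis_vec bs) \<subseteq> lie_carrier L"
  using basis_vec_in by auto

lemma closed_L: "bracket_closed L"
  using K_closed by (intro bracket_closed_based) blast

lemma expand_in_basis:
  assumes "x \<in> lie_carrier L"
  shows "x = (\<Sum>b\<in>B. x b *\<^sub>R basis_vec b)"
proof
  fix a
  have "(\<Sum>b\<in>B. x b *\<^sub>R basis_vec b) a = (\<Sum>b\<in>B. if a = b then x b else 0)"
    unfolding sum_fun_apply by (intro sum.cong) (auto simp: scaleR_fun_def basis_vec_def)
  then show "x a = (\<Sum>b\<in>B. x b *\<^sub>R basis_vec b) a"
    using assms finite_B by (auto simp: based_lie_carrier_iff)
qed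

text \<open>Entries are expanded in the basis one at a time. In the induction \<open>m\<close>
  bounds the positions that may still hold arbitrary vectors; from position \<open>m\<close> on, all
  entries are basis vectors.\<close>

lemma multilinear_forms_eqI:
  assumes f: "f \<in> multilinear_forms L k" and g: "g \<in> multilinear_forms L k"
    and eq: "\<And>bs. set bs \<subseteq> B \<Longrightarrow> length bs = k \<Longrightarrow> f (map basis_vec bs) = g (map basis_vec bs)"
  shows "f = g"
proof -
  define h where "h = f - g"
  have h: "h \<in> multilinear_forms L k"
    unfolding h_def by (intro subspace_diff[OF subspace_multilinear_forms] f g)
  have zero: "h xs = 0"
    if "m \<le> k" "length xs = k" "set xs \<subseteq> lie_carrier L" "\<forall>i. m \<le> i \<and> i < k \<longrightarrow> xs ! i \<in> basis_vec ` B"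
    for m xs
    using that
  proof (induction m arbitrary: xs)
    case 0
    then have "\<forall>x\<in>set xs. \<exists>b\<in>B. x = basis_vec b"
      by (fastforce simp: in_set_conv_nth image_iff)
    then obtain c where c: "\<And>x. x \<in> set xs \<Longrightarrow> c x \<in> B \<and> x = basis_vec (c x)" by metis
    then have "xs = map basis_vec (map c xs)" by (auto intro!: map_idI[symmetric])
    moreover have "set (map c xs) \<subseteq> B" using c by auto
    ultimately show ?case using eq[of "map c xs"] 0 by (simp add: h_def)
  next
    case (Suc m)
    have "xs ! m \<in> lie_carrier L" using Suc.prems by (auto simp: subset_iff)
    from expand_in_basis[OF this]
    have "h xs = h (xs[m := \<Sum>b\<in>B. (xs ! m) b *\<^sub>R basis_vec b])" by simp
    also have "\<dots> = (\<Sum>b\<in>B. (xs ! m) b * h (xs[m := basis_vec b]))"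
      using Suc.prems by (intro multilinear_forms_sum[OF h subspace_based_lie_carrier])
        (auto simp: finite_B basis_vec_in)
    also have "\<dots> = 0"
    proof (intro sum.neutral ballI)
      fix b assume b: "b \<in> B"
      have "\<forall>i. m \<le> i \<and> i < k \<longrightarrow> xs[m := basis_vec b] ! i \<in> basis_vec ` B"
        using Suc.prems b by (auto simp: nth_list_update)
      moreover have "set (xs[m := basis_vec b]) \<subseteq> lie_carrier L"
        by (intro set_update_subset Suc.prems basis_vec_in b)
      ultimately have "h (xs[m := basis_vec b]) = 0"
        using Suc.prems by (intro Suc.IH) simp_all
      then show "(xs ! m) b * h (xs[m := basis_vec b]) = 0" by simp
    qed
    finally show ?case .
  qed
  have "h xs = 0" for xs
  proof (cases "length xs = k \<and> set xs \<subseteq> lie_carrier L")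
    case True
    then show ?thesis using zero[of k xs] by (simp add: not_less[symmetric])
  qed (rule multilinear_forms_outside[OF h])
  then show ?thesis by (auto simp: h_def fun_eq_iff)
qed

text \<open>The operator that multiplies the component of weight \<open>n\<close> of a form by
  \<open>u n\<close>. Since the arguments mix weights, each is expanded in coordinates and every
  basis list receives its own factor.\<close>

definition weight_mult :: "nat \<Rightarrow> (real \<Rightarrow> real) \<Rightarrow> (('g \<Rightarrow> real) list \<Rightarrow> real) \<Rightarrow> ('g \<Rightarrow> real) list \<Rightarrow> real" where
  "weight_mult k u f xs =
     (if length xs = k \<and> set xs \<subseteq> lie_carrier L
      then \<Sum>bs | set bs \<subseteq> B \<and> length bs = k.
        u (weight bs) * (\<Prod>i<k. (xs ! i) (bs ! i)) * f (map basis_vec bs)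
      else 0)"

lemma multilinear_weight_mult: "weight_mult k u f \<in> multilinear_forms L k"
proof (rule multilinear_formsI)
  fix xs m a b v v'
  assume v: "v \<in> lie_carrier L" "v' \<in> lie_carrier L"
    and xs: "length xs = k" "set xs \<subseteq> lie_carrier L" and m: "m < k"
  define P where "P bs = (\<Prod>i\<in>{..<k} - {m}. (xs ! i) (bs ! i))" for bs
  have prod: "(\<Prod>i<k. (xs[m := z] ! i) (bs ! i)) = z (bs ! m) * P bs" for z bs
    using m xs by (subst prod.remove[of _ m]) (auto simp: P_def nth_list_update intro!: prod.cong)
  have eq: "weight_mult k u f (xs[m := z]) = (\<Sum>bs | set bs \<subseteq> B \<and> length bs = k.
        u (weight bs) * (z (bs ! m) * P bs) * f (map basis_vec bs))" if "z \<in> lie_carrier L" for z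
    using xs set_update_subset[OF xs(2) that] by (simp add: weight_mult_def prod)
  have "a *\<^sub>R v + b *\<^sub>R v' \<in> lie_carrier L"
    by (intro subspace_add subspace_scale subspace_based_lie_carrier v)
  then show "weight_mult k u f (xs[m := a *\<^sub>R v + b *\<^sub>R v']) =
      a * weight_mult k u f (xs[m := v]) + b * weight_mult k u f (xs[m := v'])"
    by (simp add: eq v sum_distrib_left sum.distrib[symmetric])
      (intro sum.cong refl, simp add: scaleR_fun_def algebra_simps)
qed (auto simp: weight_mult_def)

lemma weight_mult_basis:
  assumes "set cs \<subseteq> B" "length cs = k"
  shows "weight_mult k u f (map basis_vec cs) = u (weight cs) * f (map basis_vec cs)"
proof -
  have "(\<Prod>i<k. (map basis_vec cs ! i) (bs ! i)) = (if bs = cs then 1 else 0)"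
    if len: "length bs = k" for bs
  proof (cases "bs = cs")
    case False
    then obtain i where "i < k" "bs ! i \<noteq> cs ! i"
      using len assms by (auto simp: list_eq_iff_nth_eq)
    then have "\<exists>i\<in>{..<k}. (map basis_vec cs ! i) (bs ! i) = 0"
      using assms by (auto simp: basis_vec_def)
    then show ?thesis using False by simp
  qed (use assms in \<open>auto simp: basis_vec_def\<close>)
  then have "weight_mult k u f (map basis_vec cs) = (\<Sum>bs | set bs \<subseteq> B \<and> length bs = k.
      if bs = cs then u (weight bs) * f (map basis_vec bs) else 0)"
    using assms basis_vecs_in[OF assms(1)] unfolding weight_mult_def by (auto intro!: sum.cong)
  also have "\<dots> = u (weight cs) * f (map basis_vec cs)"
    using assms finite_lists_length_eq[OF finite_B] by simp
  finally show ?thesis .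
qed

text \<open>Suppose the entries at \<open>i\<close> and \<open>j\<close> coincide. Exchanging
  \<open>bs ! i\<close> and \<open>bs ! j\<close> then preserves the weight and the product of
  coordinates but reverses the sign of \<open>f\<close>, so the defining sum equals its own
  negative.\<close>

lemma weight_mult_ce_cochains:
  assumes f: "f \<in> ce_cochains L k"
  shows "weight_mult k u f \<in> ce_cochains L k"
  unfolding ce_cochains_iff
proof (intro conjI allI impI multilinear_weight_mult)
  fix xs :: "('g \<Rightarrow> real) list" assume "\<not> distinct xs"
  then obtain i j where ij: "i < length xs" "j < length xs" "i \<noteq> j" "xs ! i = xs ! j"
    by (auto simp: distinct_conv_nth)
  show "weight_mult k u f xs = 0"
  proof (cases "length xs = k \<and> set xs \<subseteq> lie_carrier L")
    case True
    define swap :: "'g list \<Rightarrow> 'g list" where "swap bs = bs[i := bs ! j, j := bs ! i]" for bs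
    define F where "F bs = u (weight bs) * (\<Prod>i<k. (xs ! i) (bs ! i)) * f (map basis_vec bs)" for bs
    let ?I = "{bs. set bs \<subseteq> B \<and> length bs = k}"
    have swap_in: "swap bs \<in> ?I" if "bs \<in> ?I" for bs
      using that ij True by (auto simp: swap_def intro!: subsetD[OF set_update_subset] set_update_subset)
    have swap_swap: "swap (swap bs) = bs" if "bs \<in> ?I" for bs
      using that ij True by (auto simp: swap_def list_eq_iff_nth_eq nth_list_update)
    have F_swap: "F (swap bs) = - F bs" if bs: "bs \<in> ?I" for bs
    proof -
      have "mset (swap bs) = mset bs"
        using that ij True by (auto simp: swap_def intro!: mset_swap)
      then have "mset (map w (swap bs)) = mset (map w bs)" by simp
      then have wt: "weight (swap bs) = weight bs" by (metis sum_mset_sum_list)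
      have "(\<Prod>l<k. (xs ! l) (swap bs ! l)) = (\<Prod>l<k. (xs ! l) (bs ! l))"
      proof -
        have e1: "(\<Prod>l<k. (xs ! l) (cs ! l)) =
            (xs ! i) (cs ! i) * ((xs ! j) (cs ! j) * (\<Prod>l\<in>{..<k} - {i} - {j}. (xs ! l) (cs ! l)))" for cs
          using ij True by (subst prod.remove[of _ i], simp, simp) (subst prod.remove[of _ j], auto)
        have e2: "(\<Prod>l\<in>{..<k} - {i} - {j}. (xs ! l) (swap bs ! l)) =
            (\<Prod>l\<in>{..<k} - {i} - {j}. (xs ! l) (bs ! l))"
          by (intro prod.cong) (auto simp: swap_def)
        show ?thesis
          unfolding e1 e2 using ij True bs by (simp add: swap_def nth_list_update)
      qed
      moreover have "f (map basis_vec (swap bs)) = - f (map basis_vec bs)"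
      proof -
        have "set (map basis_vec bs) \<subseteq> lie_carrier L" using bs by (intro basis_vecs_in) auto
        moreover have "bs ! i \<in> B" "bs ! j \<in> B" using bs ij True by (auto simp: subset_iff)
        moreover have "(map basis_vec bs)[i := basis_vec (bs ! i), j := basis_vec (bs ! j)] = map basis_vec bs"
          by (simp flip: map_update)
        ultimately show ?thesis
          using ce_cochains_swap[OF f subspace_based_lie_carrier, of "map basis_vec bs" i j
              "basis_vec (bs ! j)" "basis_vec (bs ! i)"] bs ij True
          by (simp add: swap_def map_update basis_vec_in)
      qed
      ultimately show ?thesis by (simp add: F_def wt)
    qed
    have "sum F ?I = sum (F \<circ> swap) ?I"
      by (rule sum.reindex_bij_witness[of _ swap swap]) (use swap_in swap_swap in auto)
    also have "\<dots> = - sum F ?I"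
      unfolding sum_negf[symmetric] by (intro sum.cong) (use F_swap in auto)
    finally show ?thesis using True by (simp add: weight_mult_def F_def)
  qed (auto simp: weight_mult_def)
qed

text \<open>Needed for brackets of basis vectors: these are in general not basis vectors, but
  combinations of basis vectors of one common weight, so a single scalar still comes out.\<close>

lemma weight_mult_homogeneous:
  assumes f: "f \<in> multilinear_forms L (Suc k)" and z: "z \<in> lie_carrier L"
    and hom: "\<And>b. z b \<noteq> 0 \<Longrightarrow> w b = v" and bs: "set bs \<subseteq> B" "length bs = k"
  shows "weight_mult (Suc k) u f (z # map basis_vec bs) = u (v + weight bs) * f (z # map basis_vec bs)"
proof -
  have expand: "g (z # map basis_vec bs) = (\<Sum>b\<in>B. z b * g (map basis_vec (b # bs)))"
    if g: "g \<in> multilinear_forms L (Suc k)" for g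
  proof -
    have "g ((z # map basis_vec bs)[0 := \<Sum>b\<in>B. z b *\<^sub>R basis_vec b]) =
        (\<Sum>b\<in>B. z b * g ((z # map basis_vec bs)[0 := basis_vec b]))"
      using z bs basis_vecs_in[OF bs(1)]
      by (intro multilinear_forms_sum[OF g subspace_based_lie_carrier]) (auto simp: finite_B basis_vec_in)
    then show ?thesis using expand_in_basis[OF z] by simp
  qed
  show ?thesis
    unfolding expand[OF f] expand[OF multilinear_weight_mult] sum_distrib_left
  proof (intro sum.cong refl)
    fix b assume "b \<in> B"
    then show "z b * weight_mult (Suc k) u f (map basis_vec (b # bs)) =
        u (v + weight bs) * (z b * f (map basis_vec (b # bs)))"
      using weight_mult_basis[of "b # bs" "Suc k" u f] bs hom[of b] by (cases "z b = 0") auto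
  qed
qed

lemma bracket_basis:
  assumes "b \<in> B" "c \<in> B"
  shows "lie_bracket L (basis_vec b) (basis_vec c) = K b c"
proof
  fix a
  have "lie_bracket L (basis_vec b) (basis_vec c) a =
      (\<Sum>b'\<in>B. if b' = b then \<Sum>c'\<in>B. if c' = c then K b' c' a else 0 else 0)"
    unfolding based_lie_bracket_apply by (intro sum.cong refl) (auto simp: basis_vec_def intro!: sum.cong)
  then show "lie_bracket L (basis_vec b) (basis_vec c) a = K b c a"
    using assms finite_B by simp
qed

lemma bracket_y_basis:
  assumes "b \<in> B"
  shows "lie_bracket L y (basis_vec b) = (- w b) *\<^sub>R basis_vec b"
proof
  fix a
  have "lie_bracket L y (basis_vec b) a = (\<Sum>c\<in>B. \<Sum>b'\<in>B. if b' = b then y c * K c b a else 0)"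
    unfolding based_lie_bracket_apply by (intro sum.cong refl) (auto simp: basis_vec_def)
  then show "lie_bracket L y (basis_vec b) a = ((- w b) *\<^sub>R basis_vec b) a"
    using assms finite_B y_acts[OF assms, of a] by (simp add: basis_vec_def scaleR_fun_def)
qed

text \<open>The differential preserves weight: by additivity, every shortened list in it has the
  weight of \<open>bs\<close>, so the multiplier is a common factor of all terms.\<close>

lemma ce_differential_weight_mult:
  assumes h: "h \<in> multilinear_forms L k" and bs: "set bs \<subseteq> B" "length bs = Suc k"
  shows "ce_differential L k (weight_mult k u h) (map basis_vec bs) =
    u (weight bs) * ce_differential L k h (map basis_vec bs)"
proof -
  have "weight_mult k u h
          (lie_bracket L (map basis_vec bs ! i) (map basis_vec bs ! j) # nths (map basis_vec bs) (- {i, j})) =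
        u (weight bs) *
          h (lie_bracket L (map basis_vec bs ! i) (map basis_vec bs ! j) # nths (map basis_vec bs) (- {i, j}))"
    if ij: "i < j" "j < Suc k" for i j
  proof -
    obtain l where k: "k = Suc l" using ij by (cases k) auto
    have in_B: "bs ! i \<in> B" "bs ! j \<in> B" using bs ij by (auto simp: subset_iff)
    have "K (bs ! i) (bs ! j) \<in> lie_carrier L"
      using K_closed[OF in_B] by (auto simp: based_lie_carrier_iff)
    moreover have "set (nths bs (- {i, j})) \<subseteq> B" by (rule subset_trans[OF set_nths_subset bs(1)])
    moreover have "length (nths bs (- {i, j})) = l"
      using length_nths_Compl_pair[of i j bs] ij bs k by simp
    ultimately have "weight_mult k u h (K (bs ! i) (bs ! j) # map basis_vec (nths bs (- {i, j}))) =
        u (w (bs ! i) + w (bs ! j) + weight (nths bs (- {i, j}))) *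
          h (K (bs ! i) (bs ! j) # map basis_vec (nths bs (- {i, j})))"
      using K_weight[OF in_B] h unfolding k by (intro weight_mult_homogeneous) auto
    then show ?thesis
      using ij bs in_B sum_list_nths_Compl_pair[of i j bs w] by (simp add: bracket_basis nths_map)
  qed
  note eq = this
  show ?thesis
    using bs basis_vecs_in[OF bs(1)] unfolding ce_differential_def sum_distrib_left
    by (simp only: length_map simp_thms if_True sum_distrib_left)
      (intro sum.cong refl, simp only: eq lessThan_iff mult.left_commute)
qed

section \<open>Contraction with the grading element\<close>

definition contract :: "(('g \<Rightarrow> real) list \<Rightarrow> real) \<Rightarrow> ('g \<Rightarrow> real) list \<Rightarrow> real" where
  "contract f = (\<lambda>xs. f (y # xs))"

lemma contract_ce_cochains:
  assumes f: "f \<in> ce_cochains L (Suc k)"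
  shows "contract f \<in> ce_cochains L k"
  unfolding ce_cochains_iff
proof (intro conjI allI impI)
  have m: "f \<in> multilinear_forms L (Suc k)" using f by (simp add: ce_cochains_iff)
  show "contract f \<in> multilinear_forms L k"
  proof (rule multilinear_formsI)
    fix xs i a b u v
    assume "u \<in> lie_carrier L" "v \<in> lie_carrier L" "length xs = k" "set xs \<subseteq> lie_carrier L" "i < k"
    then show "contract f (xs[i := a *\<^sub>R u + b *\<^sub>R v]) = a * contract f (xs[i := u]) + b * contract f (xs[i := v])"
      using multilinear_forms_update[OF m, of u v "y # xs" "Suc i" a b] y_in_L by (simp add: contract_def)
  qed (use multilinear_forms_outside[OF m] y_in_L in \<open>auto simp: contract_def\<close>)
qed (use f in \<open>auto simp: contract_def ce_cochains_iff\<close>)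

text \<open>Cartan's formula for the Lie derivative along \<open>y\<close>, evaluated on a list of basis vectors.\<close>

lemma ce_differential_contract:
  assumes f: "f \<in> ce_cocycles L (Suc k)" and bs: "set bs \<subseteq> B" "length bs = Suc k"
  shows "ce_differential L k (contract f) (map basis_vec bs) = weight bs * f (map basis_vec bs)"
proof -
  have fc: "f \<in> ce_cochains L (Suc k)" and df: "ce_differential L (Suc k) f = 0"
    using f by (auto simp: ce_cocycles_def)
  have m: "f \<in> multilinear_forms L (Suc k)" using fc by (simp add: ce_cochains_iff)
  let ?xs = "map basis_vec bs"
  have xs: "set ?xs \<subseteq> lie_carrier L" by (rule basis_vecs_in[OF bs(1)])
  \<comment> \<open>Terms that pair \<open>y\<close> with an entry. The bracket yields the factor
    \<open>- w (bs ! j)\<close>, moving the entry back to position \<open>j\<close> costs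
    \<open>(- 1) ^ j\<close>, and the sign of the term is \<open>(- 1) ^ Suc j\<close>; in total the
    factor is \<open>w (bs ! j)\<close>.\<close>
  have action: "(- 1) ^ Suc j * f (lie_bracket L y (?xs ! j) # nths (y # ?xs) (- {0, Suc j})) = w (bs ! j) * f ?xs"
    if j: "j < Suc k" for j
  proof -
    have b: "bs ! j \<in> B" using bs j by (auto simp: subset_iff)
    let ?rest = "take j ?xs @ drop (Suc j) ?xs"
    have rest: "set ?rest \<subseteq> lie_carrier L" "length ?rest = k"
      using subset_trans[OF set_take_subset xs, of j] subset_trans[OF set_drop_subset xs, of "Suc j"] bs j
      by simp_all
    have "f ((- w (bs ! j)) *\<^sub>R basis_vec (bs ! j) # ?rest) = - w (bs ! j) * f (basis_vec (bs ! j) # ?rest)"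
      using multilinear_forms_update[OF m, of "basis_vec (bs ! j)" 0 "0 # ?rest" 0 "- w (bs ! j)" 0]
        rest basis_vec_in[OF b] by (simp add: subspace_0[OF subspace_based_lie_carrier])
    also have "f (basis_vec (bs ! j) # ?rest) = (- 1) ^ j * f (take j ?xs @ basis_vec (bs ! j) # drop (Suc j) ?xs)"
      using ce_cochains_move[OF fc subspace_based_lie_carrier, of "[]" "basis_vec (bs ! j)" "take j ?xs" "drop (Suc j) ?xs"]
        rest basis_vec_in[OF b] bs j by simp
    also have "take j ?xs @ basis_vec (bs ! j) # drop (Suc j) ?xs = ?xs"
      using id_take_nth_drop[of j ?xs] bs j by simp
    finally have eq: "f ((- w (bs ! j)) *\<^sub>R basis_vec (bs ! j) # ?rest) = - w (bs ! j) * ((- 1) ^ j * f ?xs)" .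
    have br: "lie_bracket L y (?xs ! j) = (- w (bs ! j)) *\<^sub>R basis_vec (bs ! j)"
      using bs j bracket_y_basis[OF b] by simp
    have sign: "(- 1 :: real) ^ j * (- 1) ^ j = 1" by (simp flip: power_mult_distrib)
    have "(- 1) ^ Suc j * (- w (bs ! j) * ((- 1) ^ j * f ?xs)) = ((- 1) ^ j * (- 1) ^ j) * (w (bs ! j) * f ?xs)"
      by (simp add: mult_ac)
    then show ?thesis
      unfolding br nths_Cons_Compl_0_Suc nths_Compl_singleton eq sign by simp
  qed
  \<comment> \<open>In the other terms \<open>y\<close> stays in the list, directly behind the
    bracket; exchanging the two gives the sign. Shifting both indices by one leaves
    \<open>(- 1) ^ (i + j)\<close> unchanged.\<close>
  have swap: "f (lie_bracket L (?xs ! i) (?xs ! j) # nths (y # ?xs) (- {Suc i, Suc j})) =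
      - contract f (lie_bracket L (?xs ! i) (?xs ! j) # nths ?xs (- {i, j}))"
    if ij: "i < j" "j < Suc k" for i j
  proof -
    have "?xs ! i \<in> lie_carrier L" "?xs ! j \<in> lie_carrier L"
      using xs bs ij nth_mem[of i ?xs] nth_mem[of j ?xs] by (auto simp del: nth_mem)
    then have "lie_bracket L (?xs ! i) (?xs ! j) \<in> lie_carrier L"
      by (rule bracket_closedD[OF closed_L])
    moreover have "set (nths ?xs (- {i, j})) \<subseteq> lie_carrier L"
      by (rule subset_trans[OF set_nths_subset xs])
    moreover have "length (nths ?xs (- {i, j})) = k - 1" "k > 0"
      using length_nths_Compl_pair[of i j ?xs] ij bs by auto
    ultimately show ?thesis
      using ce_cochains_move[OF fc subspace_based_lie_carrier, of "[]" "lie_bracket L (?xs ! i) (?xs ! j)"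
          "[y]" "nths ?xs (- {i, j})"] y_in_L
      by (simp add: nths_Cons_Compl_Suc_Suc contract_def)
  qed
  \<comment> \<open>For a cocycle one of the two summands in Cartan's formula vanishes. Evaluating
    \<open>d f = 0\<close> with \<open>y\<close> prepended expresses the other through the action of
    \<open>y\<close>.\<close>
  have "0 = ce_differential L (Suc k) f (y # ?xs)" by (simp add: df)
  also have "\<dots> = (\<Sum>j<Suc k. (- 1) ^ Suc j * f (lie_bracket L y (?xs ! j) # nths (y # ?xs) (- {0, Suc j})) +
      (\<Sum>i<j. (- 1) ^ (i + j) * f (lie_bracket L (?xs ! i) (?xs ! j) # nths (y # ?xs) (- {Suc i, Suc j}))))"
    using xs y_in_L bs
    by (simp add: ce_differential_def sum.lessThan_Suc_shift del: sum.lessThan_Suc)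
  also have "\<dots> = (\<Sum>j<Suc k. w (bs ! j) * f ?xs +
      (\<Sum>i<j. - ((- 1) ^ (i + j) * contract f (lie_bracket L (?xs ! i) (?xs ! j) # nths ?xs (- {i, j})))))"
    by (intro sum.cong refl arg_cong2[where f = "(+)"] action) (auto simp: swap)
  also have "\<dots> = weight bs * f ?xs - ce_differential L k (contract f) ?xs"
    using xs bs unfolding ce_differential_def
    by (simp add: sum_subtractf sum_negf sum_list_sum_nth atLeast0LessThan sum_distrib_right del: sum.lessThan_Suc)
  finally show ?thesis by simp
qed

section \<open>The projection onto weight zero\<close>

definition weight_zero_part :: "('g \<Rightarrow> real) \<Rightarrow> 'g \<Rightarrow> real" where
  "weight_zero_part x = (\<lambda>b. if b \<in> B \<and> w b = 0 then x b else 0)"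

text \<open>The generators of positive weight span an ideal: nonnegative weights cannot cancel, so a
  bracket with one factor of positive weight has positive weight again.\<close>

lemma lie_hom_weight_zero_part: "lie_hom L L weight_zero_part"
  unfolding lie_hom_def
proof (intro conjI ballI)
  show "linear weight_zero_part"
    by (rule linearI) (auto simp: weight_zero_part_def scaleR_fun_def fun_eq_iff)
  show "weight_zero_part ` lie_carrier L \<subseteq> lie_carrier L"
    by (auto simp: weight_zero_part_def based_lie_carrier_iff)
next
  fix x z assume "x \<in> lie_carrier L" "z \<in> lie_carrier L"
  show "weight_zero_part (lie_bracket L x z) = lie_bracket L (weight_zero_part x) (weight_zero_part z)"
  proof
    fix a
    have "weight_zero_part x b * weight_zero_part z c * K b c a = (if a \<in> B \<and> w a = 0 then x b * z c * K b c a else 0)"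
      if "b \<in> B" "c \<in> B" for b c
      using K_closed[OF that, of a] K_weight[OF that, of a] w_nonneg[OF that(1)] w_nonneg[OF that(2)] that
      by (cases "K b c a = 0") (auto simp: weight_zero_part_def)
    then have "lie_bracket L (weight_zero_part x) (weight_zero_part z) a =
        (\<Sum>b\<in>B. \<Sum>c\<in>B. if a \<in> B \<and> w a = 0 then x b * z c * K b c a else 0)"
      unfolding based_lie_bracket_apply by (intro sum.cong refl)
    then show "weight_zero_part (lie_bracket L x z) a = lie_bracket L (weight_zero_part x) (weight_zero_part z) a"
      by (auto simp: based_lie_bracket_apply weight_zero_part_def[of "lie_bracket L x z"])
  qed
qed

text \<open>A list of nonzero weight has an entry of nonzero weight; the projection sends that entry
  to zero, and multilinearity makes the value vanish.\<close>

lemma pullback_weight_zero_part_basis: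
  assumes f: "f \<in> multilinear_forms L k" and bs: "set bs \<subseteq> B" "length bs = k"
  shows "pullback L weight_zero_part f (map basis_vec bs) = (if weight bs = 0 then f (map basis_vec bs) else 0)"
proof -
  have zero_part: "weight_zero_part (basis_vec b) = (if w b = 0 then basis_vec b else 0)" if "b \<in> B" for b
    using that by (auto simp: weight_zero_part_def basis_vec_def fun_eq_iff)
  have iff: "weight bs = 0 \<longleftrightarrow> (\<forall>b\<in>set bs. w b = 0)"
    using bs w_nonneg by (subst sum_list_nonneg_eq_0_iff) auto
  show ?thesis
  proof (cases "weight bs = 0")
    case True
    then have "map weight_zero_part (map basis_vec bs) = map basis_vec bs"
      using iff bs by (auto simp: zero_part)
    then show ?thesis using True basis_vecs_in[OF bs(1)] by (simp add: pullback_def del: map_map)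
  next
    case False
    then obtain j where j: "j < length bs" "w (bs ! j) \<noteq> 0"
      using iff by (metis in_set_conv_nth)
    let ?zs = "map weight_zero_part (map basis_vec bs)"
    have zs: "set ?zs \<subseteq> lie_carrier L" "length ?zs = k"
      using lie_hom_weight_zero_part basis_vecs_in[OF bs(1)] bs by (auto simp: lie_hom_def)
    have "?zs ! j = 0" using j bs nth_mem[OF j(1)] by (auto simp: zero_part subset_iff)
    \<comment> \<open>The zero entry is written as a linear combination with zero coefficients, so
      that linearity at position \<open>j\<close> gives the value \<open>0\<close>.\<close>
    then have id: "?zs[j := 0 *\<^sub>R 0 + 0 *\<^sub>R 0] = ?zs" using list_update_id[of ?zs j] by simp
    have zero: "0 \<in> lie_carrier L" by (rule subspace_0[OF subspace_based_lie_carrier])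
    have "j < k" using j bs by simp
    from multilinear_forms_update[OF f zero zero zs(2,1) this, of 0 0]
    have "f ?zs = 0" unfolding id by simp
    then show ?thesis using False basis_vecs_in[OF bs(1)] by (simp add: pullback_def)
  qed
qed

text \<open>
  The primitive of a cocycle \<open>f\<close> of nonzero weight \<open>n\<close> is \<open>contract f\<close> divided by \<open>n\<close>.
  Since \<open>inverse 0 = 0\<close>, the multiplier \<open>inverse\<close> discards the part of weight zero.
\<close>

lemma cocycle_minus_weight_zero_part:
  assumes f: "f \<in> ce_cocycles L k"
  shows "f - pullback L weight_zero_part f \<in> ce_coboundaries L k"
proof -
  note sub = subspace_based_lie_carrier[of B K]
  have fc: "f \<in> ce_cochains L k" using f by (simp add: ce_cocycles_def)
  have m: "f \<in> multilinear_forms L k" using fc by (simp add: ce_cochains_iff)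
  have "pullback L weight_zero_part f \<in> ce_cochains L k"
    by (rule pullback_ce_cochains[OF lie_hom_weight_zero_part sub fc])
  then have diff: "f - pullback L weight_zero_part f \<in> multilinear_forms L k"
    using m by (auto simp: ce_cochains_iff intro: subspace_diff[OF subspace_multilinear_forms])
  show ?thesis
  proof (cases k)
    case 0
    \<comment> \<open>In degree \<open>0\<close> the only coboundary is \<open>0\<close>. The only
      argument is the empty list, which the projection leaves unchanged.\<close>
    have "f - pullback L weight_zero_part f = 0"
      using m 0 by (intro multilinear_forms_eqI[OF diff subspace_0[OF subspace_multilinear_forms]])
        (simp add: pullback_def)
    then show ?thesis by (simp add: ce_coboundaries_def 0)
  next
    case (Suc l)
    let ?g = "weight_mult l inverse (contract f)"
    have cf: "contract f \<in> ce_cochains L l" using fc Suc by (simp add: contract_ce_cochains)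
    have g: "?g \<in> ce_cochains L l" by (rule weight_mult_ce_cochains[OF cf])
    have "f - pullback L weight_zero_part f = ce_differential L l ?g"
    proof (rule multilinear_forms_eqI[OF diff])
      show "ce_differential L l ?g \<in> multilinear_forms L k"
        unfolding Suc
        by (rule multilinear_ce_differential[OF multilinear_weight_mult sub closed_L
              based_lie_bracket_left based_lie_bracket_right])
    next
      fix bs assume bs: "set bs \<subseteq> B" "length bs = k"
      have "ce_differential L l ?g (map basis_vec bs) = inverse (weight bs) * (weight bs * f (map basis_vec bs))"
        using ce_differential_weight_mult[of "contract f" l bs inverse] cf bs f Suc
        by (simp add: ce_differential_contract ce_cochains_iff)
      then show "(f - pullback L weight_zero_part f) (map basis_vec bs) = ce_differential L l ?g (map basis_vec bs)"
        using pullback_weight_zero_part_basis[OF m bs] by simp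
    qed
    then show ?thesis using g by (simp add: ce_coboundaries_def Suc)
  qed
qed

text \<open>\<open>\<tau>\<close> renames the generators of the smaller algebra to those of weight
  zero. \<open>K'\<close> is matched with \<open>K\<close> only within \<open>D\<close>, since
  \<open>\<tau>\<close> is uncontrolled elsewhere; \<open>closed'\<close> settles the components
  outside \<open>D\<close>.\<close>

lemma vspace_iso_ce_cohomology_weight_zero:
  fixes D :: "'h set"
  assumes bij: "bij_betw \<tau> D {b \<in> B. w b = 0}"
    and K': "\<And>a b c. a \<in> D \<Longrightarrow> b \<in> D \<Longrightarrow> c \<in> D \<Longrightarrow> K' b c a = K (\<tau> b) (\<tau> c) (\<tau> a)"
    and closed': "\<And>a b c. b \<in> D \<Longrightarrow> c \<in> D \<Longrightarrow> a \<notin> D \<Longrightarrow> K' b c a = 0"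
  shows "vspace_iso (ce_cohomology L k) (ce_cohomology (based_lie_algebra D K') k)"
proof -
  let ?M = "based_lie_algebra D K'"
  let ?B0 = "{b \<in> B. w b = 0}"
  have \<tau>_in: "\<tau> d \<in> B" "w (\<tau> d) = 0" if "d \<in> D" for d
    using bij_betwE[OF bij] that by auto
  define \<iota> where "\<iota> x = (\<lambda>b. if b \<in> ?B0 then x (inv_into D \<tau> b) else 0)" for x :: "'h \<Rightarrow> real"
  define \<rho> where "\<rho> x = (\<lambda>d. if d \<in> D then x (\<tau> d) else 0)" for x :: "'g \<Rightarrow> real"
  have \<iota>_\<tau>: "\<iota> x (\<tau> d) = x d" if "d \<in> D" for x d
    using \<tau>_in[OF that] that bij by (simp add: \<iota>_def bij_betw_inv_into_left)
  have \<iota>_out: "\<iota> x b = 0" if "b \<notin> ?B0" for x b using that by (auto simp: \<iota>_def)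
  have reindex: "sum h ?B0 = (\<Sum>d\<in>D. h (\<tau> d))" for h :: "'g \<Rightarrow> real"
    using sum.reindex_bij_betw[OF bij, of h] by simp
  have bracket: "lie_bracket L x z (\<tau> a) = (\<Sum>d\<in>D. \<Sum>e\<in>D. x (\<tau> d) * z (\<tau> e) * K (\<tau> d) (\<tau> e) (\<tau> a))"
    if a: "a \<in> D" for x z a
  proof -
    \<comment> \<open>A component of weight zero cannot come from a factor of positive weight, so
      the double sum shrinks to generators of weight zero.\<close>
    have K0: "K b c (\<tau> a) = 0" if "b \<in> B" "c \<in> B" "b \<notin> ?B0 \<or> c \<notin> ?B0" for b c
      using K_weight[OF that(1,2), of "\<tau> a"] \<tau>_in[OF a] w_nonneg[OF that(1)] w_nonneg[OF that(2)] that
      by (cases "K b c (\<tau> a) = 0") auto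
    have "lie_bracket L x z (\<tau> a) = (\<Sum>b\<in>?B0. \<Sum>c\<in>B. x b * z c * K b c (\<tau> a))"
      unfolding based_lie_bracket_apply
      by (rule sum.mono_neutral_right) (use finite_B K0 in \<open>auto intro!: sum.neutral\<close>)
    also have "\<dots> = (\<Sum>b\<in>?B0. \<Sum>c\<in>?B0. x b * z c * K b c (\<tau> a))"
      by (intro sum.cong refl sum.mono_neutral_right) (use finite_B K0 in auto)
    finally show ?thesis by (simp only: reindex)
  qed
  have "lie_hom ?M L \<iota>"
    unfolding lie_hom_def
  proof (intro conjI ballI)
    show "linear \<iota>" by (rule linearI) (auto simp: \<iota>_def scaleR_fun_def fun_eq_iff)
    show "\<iota> ` lie_carrier ?M \<subseteq> lie_carrier L" by (auto simp: \<iota>_def based_lie_carrier_iff)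
    fix x z assume "x \<in> lie_carrier ?M" "z \<in> lie_carrier ?M"
    show "\<iota> (lie_bracket ?M x z) = lie_bracket L (\<iota> x) (\<iota> z)"
    proof
      fix b
      show "\<iota> (lie_bracket ?M x z) b = lie_bracket L (\<iota> x) (\<iota> z) b"
      proof (cases "b \<in> ?B0")
        case True
        then obtain a where a: "a \<in> D" "b = \<tau> a" using bij by (auto simp: bij_betw_def)
        show ?thesis
          unfolding a(2) \<iota>_\<tau>[OF a(1)] bracket[OF a(1)]
          by (simp add: based_lie_bracket_apply \<iota>_\<tau> K' a(1))
      next
        case False
        \<comment> \<open>Both factors are supported in weight zero, and their bracket has no
          component outside weight zero.\<close>
        have "\<iota> x b' * \<iota> z c' * K b' c' b = 0" if "b' \<in> B" "c' \<in> B" for b' c'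
          using K_closed[OF that, of b] K_weight[OF that, of b] False
          by (auto simp: \<iota>_def)
        then have "lie_bracket L (\<iota> x) (\<iota> z) b = 0"
          unfolding based_lie_bracket_apply by (simp only: sum.neutral_const cong: sum.cong)
        then show ?thesis using False by (simp add: \<iota>_out)
      qed
    qed
  qed
  moreover have "lie_hom L ?M \<rho>"
    unfolding lie_hom_def
  proof (intro conjI ballI)
    show "linear \<rho>" by (rule linearI) (auto simp: \<rho>_def scaleR_fun_def fun_eq_iff)
    show "\<rho> ` lie_carrier L \<subseteq> lie_carrier ?M" by (auto simp: \<rho>_def based_lie_carrier_iff)
    fix x z assume "x \<in> lie_carrier L" "z \<in> lie_carrier L"
    show "\<rho> (lie_bracket L x z) = lie_bracket ?M (\<rho> x) (\<rho> z)"
    proof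
      fix a
      show "\<rho> (lie_bracket L x z) a = lie_bracket ?M (\<rho> x) (\<rho> z) a"
      proof (cases "a \<in> D")
        case True
        then have "\<rho> (lie_bracket L x z) a = lie_bracket L x z (\<tau> a)" by (simp add: \<rho>_def)
        also have "\<dots> = lie_bracket ?M (\<rho> x) (\<rho> z) a"
          unfolding bracket[OF True] using True by (simp add: based_lie_bracket_apply \<rho>_def K')
        finally show ?thesis .
      qed (simp add: \<rho>_def based_lie_bracket_apply closed')
    qed
  qed
  moreover have "\<rho> (\<iota> x) = x" if "x \<in> lie_carrier ?M" for x
    using that by (auto simp: \<rho>_def \<iota>_\<tau> based_lie_carrier_iff fun_eq_iff)
  moreover have "\<iota> \<circ> \<rho> = weight_zero_part"
  proof (intro ext)
    fix x b
    show "(\<iota> \<circ> \<rho>) x b = weight_zero_part x b"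
    proof (cases "b \<in> ?B0")
      case True
      then obtain a where a: "a \<in> D" "b = \<tau> a" using bij by (auto simp: bij_betw_def)
      then show ?thesis using True by (simp add: \<iota>_\<tau> \<rho>_def weight_zero_part_def)
    qed (auto simp: \<iota>_out weight_zero_part_def)
  qed
  ultimately show ?thesis
    using cocycle_minus_weight_zero_part closed' closed_L
    by (intro vspace_iso_ce_cohomology_retract[where i = \<iota> and r = \<rho>])
      (auto intro!: subspace_based_lie_carrier bracket_closed_based)
qed

end

section \<open>Graph Lie algebras\<close>

definition graph_bracket :: "'a::linorder graph \<Rightarrow> 'a set list \<Rightarrow> 'a gen \<Rightarrow> 'a gen \<Rightarrow> 'a gen \<Rightarrow> real" where
  "graph_bracket G S b c = bracket_rule G S b c - bracket_rule G S c b"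

lemma graph_lie_algebra_eq: "graph_lie_algebra G S = based_lie_algebra (lie_gens G S) (graph_bracket G S)"
  by (simp add: graph_lie_algebra_def based_lie_algebra_def graph_bracket_def)

lemma lie_gens_simps [simp]:
  "XV i \<in> lie_gens G S \<longleftrightarrow> i \<in> verts G"
  "XE i j \<in> lie_gens G S \<longleftrightarrow> i < j \<and> {i, j} \<in> edges G"
  "Y k \<in> lie_gens G S \<longleftrightarrow> k < length S"
  by (auto simp: lie_gens_def)

lemma finite_lie_gens:
  assumes "finite_simple_graph G"
  shows "finite (lie_gens G S)"
proof -
  have "{XE i j |i j. i < j \<and> {i, j} \<in> edges G} \<subseteq> (\<lambda>(i, j). XE i j) ` (verts G \<times> verts G)"
    using assms by (fastforce simp: finite_simple_graph_def doubleton_eq_iff)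
  then have "finite {XE i j |i j. i < j \<and> {i, j} \<in> edges G}"
    by (rule finite_subset) (use assms in \<open>auto simp: finite_simple_graph_def\<close>)
  then show ?thesis using assms by (simp add: lie_gens_def finite_simple_graph_def)
qed

lemma graph_bracket_closed:
  "b \<in> lie_gens G S \<Longrightarrow> c \<in> lie_gens G S \<Longrightarrow> graph_bracket G S b c a \<noteq> 0 \<Longrightarrow> a \<in> lie_gens G S"
  by (cases b; cases c)
    (auto simp: graph_bracket_def gen_vec_def scaleR_fun_def insert_commute split: if_splits)

section \<open>The grading of a graph Lie algebra\<close>

fun gen_weight :: "'a set list \<Rightarrow> 'a gen \<Rightarrow> real" where
  "gen_weight S (XV i) = (\<Sum>k<length S. real (card ({i} \<inter> S ! k)))"
| "gen_weight S (XE i j) = (\<Sum>k<length S. real (card ({i, j} \<inter> S ! k)))"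
| "gen_weight S (Y k) = 0"

lemma gen_weight_nonneg: "0 \<le> gen_weight S b"
  by (cases b) (auto intro: sum_nonneg)

lemma gen_weight_edge: "i \<noteq> j \<Longrightarrow> gen_weight S (XE i j) = gen_weight S (XV i) + gen_weight S (XV j)"
  by (auto simp: sum.distrib[symmetric] Int_insert_left intro!: sum.cong)

text \<open>An edge with just one end in a clique already has positive weight. Edges of weight zero
  are thus those with both ends outside all cliques, as in the induced subgraph.\<close>

lemma gen_weight_eq_0_iff:
  "gen_weight S (XV i) = 0 \<longleftrightarrow> i \<notin> \<Union>(set S)"
  "gen_weight S (XE i j) = 0 \<longleftrightarrow> i \<notin> \<Union>(set S) \<and> j \<notin> \<Union>(set S)"
  by (auto simp: sum_nonneg_eq_0_iff Int_insert_left all_set_conv_all_nth split: if_splits)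

text \<open>There are two kinds of nonzero brackets: two vertices give their edge, whose weight is
  the sum of theirs, and bracketing with a \<open>Y k\<close>, of weight zero, rescales a
  generator.\<close>

lemma graph_bracket_weight:
  "graph_bracket G S b c a \<noteq> 0 \<Longrightarrow> gen_weight S a = gen_weight S b + gen_weight S c"
  by (cases b; cases c)
    (auto simp: graph_bracket_def gen_vec_def scaleR_fun_def gen_weight_edge
      simp del: gen_weight.simps(1,2) split: if_splits)

text \<open>A single \<open>Y k\<close> detects only its own clique; the sum over all
  \<open>k\<close> gives positive weight to every vertex that lies in at least one clique.\<close>

definition sum_of_cliques :: "'a set list \<Rightarrow> 'a gen \<Rightarrow> real" where
  "sum_of_cliques S b = (case b of Y k \<Rightarrow> if k < length S then 1 else 0 | _ \<Rightarrow> 0)"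

text \<open>With \<open>Y k\<close> on the left only the rule for the reversed pair contributes,
  hence the minus sign.\<close>

lemma sum_of_cliques_acts:
  assumes "finite (lie_gens G S)"
  shows "(\<Sum>c\<in>lie_gens G S. sum_of_cliques S c * graph_bracket G S c b a) = (if a = b then - gen_weight S b else 0)"
proof -
  have "(\<Sum>c\<in>lie_gens G S. sum_of_cliques S c * graph_bracket G S c b a) =
      (\<Sum>c\<in>Y ` {..<length S}. sum_of_cliques S c * graph_bracket G S c b a)"
    by (rule sum.mono_neutral_right[OF assms])
      (auto simp: lie_gens_def sum_of_cliques_def split: gen.splits)
  also have "\<dots> = (\<Sum>k<length S. graph_bracket G S (Y k) b a)"
    by (subst sum.reindex) (auto simp: inj_on_def sum_of_cliques_def)
  also have "\<dots> = (if a = b then - gen_weight S b else 0)"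
    by (cases b) (auto simp: graph_bracket_def gen_vec_def scaleR_fun_def sum_negf)
  finally show ?thesis .
qed

lemma weighted_lie_algebra_graph:
  assumes "finite_simple_graph G"
  shows "weighted_lie_algebra (lie_gens G S) (graph_bracket G S) (gen_weight S) (sum_of_cliques S)"
proof
  show "finite (lie_gens G S)" using assms by (rule finite_lie_gens)
  then show "(\<Sum>c\<in>lie_gens G S. sum_of_cliques S c * graph_bracket G S c b a) = (if a = b then - gen_weight S b else 0)"
    for a b by (rule sum_of_cliques_acts)
  show "sum_of_cliques S b = 0" if "b \<notin> lie_gens G S" for b
    using that by (auto simp: sum_of_cliques_def split: gen.splits)
qed (auto intro: graph_bracket_closed graph_bracket_weight gen_weight_nonneg)

text \<open>Isolated vertices are numbered from \<open>1\<close> and cliques from \<open>0\<close>,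
  whence \<open>m - 1\<close>. The remaining patterns are not generators of the smaller algebra: its
  isolated vertices have no edges, and its list of cliques is empty.\<close>

fun to_weight_zero_gen :: "('a + nat) gen \<Rightarrow> 'a gen" where
  "to_weight_zero_gen (XV (Inl i)) = XV i"
| "to_weight_zero_gen (XV (Inr m)) = Y (m - 1)"
| "to_weight_zero_gen (XE (Inl i) (Inl j)) = XE i j"
| "to_weight_zero_gen _ = undefined"

fun of_weight_zero_gen :: "'a gen \<Rightarrow> ('a + nat) gen" where
  "of_weight_zero_gen (XV i) = XV (Inl i)"
| "of_weight_zero_gen (Y k) = XV (Inr (Suc k))"
| "of_weight_zero_gen (XE i j) = XE (Inl i) (Inl j)"

lemma edge_disjoint_union_edgeless:
  fixes u v :: "'a + nat"
  shows "{u, v} \<in> edges (graph_disjoint_union G (edgeless_graph m)) \<longleftrightarrow>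
    (\<exists>i j. u = Inl i \<and> v = Inl j \<and> {i, j} \<in> edges G)"
proof
  assume "{u, v} \<in> edges (graph_disjoint_union G (edgeless_graph m))"
  then obtain e where e: "e \<in> edges G" "{u, v} = Inl ` e"
    by (auto simp: graph_disjoint_union_def edgeless_graph_def)
  then obtain i j where ij: "u = Inl i" "v = Inl j" by blast
  then have "(Inl ` {i, j} :: ('a + nat) set) = Inl ` e" using e by simp
  then have "{i, j} = e" by (simp only: inj_image_eq_iff inj_Inl)
  then show "\<exists>i j. u = Inl i \<and> v = Inl j \<and> {i, j} \<in> edges G" using e ij by auto
qed (auto simp: graph_disjoint_union_def image_iff intro!: bexI[of _ "{_, _}"])

lemma vert_disjoint_union_edgeless:
  "Inl i \<in> verts (graph_disjoint_union G (edgeless_graph m)) \<longleftrightarrow> i \<in> verts G"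
  "Inr n \<in> verts (graph_disjoint_union G (edgeless_graph m)) \<longleftrightarrow> 1 \<le> n \<and> n \<le> m"
  by (auto simp: graph_disjoint_union_def edgeless_graph_def)

lemma Inl_less_Inl: "(Inl i :: 'a::linorder + 'b::linorder) < Inl j \<longleftrightarrow> i < j"
  by (auto simp: less_sum_def)

theorem theorem40:
  fixes G :: "'a::linorder graph" and S :: "'a set list" and k :: nat
  assumes "finite_simple_graph G"
    and "\<forall>C\<in>set S. clique G C"
  defines "G' \<equiv> induced_subgraph G (verts G - \<Union>(set S))"
  shows "vspace_iso
    (ce_cohomology (graph_lie_algebra G S) k)
    (ce_cohomology
      (graph_lie_algebra (graph_disjoint_union G' (edgeless_graph (length S))) []) k)"
proof -
  interpret weighted_lie_algebra "lie_gens G S" "graph_bracket G S" "gen_weight S" "sum_of_cliques S"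
    by (rule weighted_lie_algebra_graph[OF assms(1)])
  let ?H = "graph_disjoint_union G' (edgeless_graph (length S))"
  have verts: "i \<in> verts G' \<longleftrightarrow> i \<in> verts G \<and> i \<notin> \<Union>(set S)" for i
    by (auto simp: G'_def induced_subgraph_def)
  have ends: "i \<in> verts G" "j \<in> verts G" if "{i, j} \<in> edges G" for i j
    using assms(1) that by (auto simp: finite_simple_graph_def doubleton_eq_iff)
  have edges: "{i, j} \<in> edges G' \<longleftrightarrow> {i, j} \<in> edges G \<and> i \<notin> \<Union>(set S) \<and> j \<notin> \<Union>(set S)" for i j
    using ends[of i j] by (auto simp: G'_def induced_subgraph_def)
  have gens_cases: "(\<exists>i. b = XV (Inl i) \<and> i \<in> verts G') \<or>
      (\<exists>m. b = XV (Inr (Suc m)) \<and> m < length S) \<or>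
      (\<exists>i j. b = XE (Inl i) (Inl j) \<and> i < j \<and> {i, j} \<in> edges G')"
    if "b \<in> lie_gens ?H []" for b
  proof (cases b)
    case (XV v)
    then show ?thesis using that
      by (cases v) (auto simp: vert_disjoint_union_edgeless gr0_conv_Suc Suc_le_eq)
  qed (use that in \<open>auto simp: edge_disjoint_union_edgeless Inl_less_Inl\<close>)
  have bij: "bij_betw to_weight_zero_gen (lie_gens ?H []) {b \<in> lie_gens G S. gen_weight S b = 0}"
  proof (rule bij_betwI[where g = of_weight_zero_gen])
    show "to_weight_zero_gen \<in> lie_gens ?H [] \<rightarrow> {b \<in> lie_gens G S. gen_weight S b = 0}"
      by (auto dest!: gens_cases simp: verts edges gen_weight_eq_0_iff simp del: gen_weight.simps(1,2))
    show "of_weight_zero_gen \<in> {b \<in> lie_gens G S. gen_weight S b = 0} \<rightarrow> lie_gens ?H []"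
    proof
      fix b assume "b \<in> {b \<in> lie_gens G S. gen_weight S b = 0}"
      then show "of_weight_zero_gen b \<in> lie_gens ?H []"
        by (cases b) (auto simp: verts edges gen_weight_eq_0_iff vert_disjoint_union_edgeless
            edge_disjoint_union_edgeless Inl_less_Inl simp del: gen_weight.simps(1,2))
    qed
    show "of_weight_zero_gen (to_weight_zero_gen b) = b" if "b \<in> lie_gens ?H []" for b
      using gens_cases[OF that] by auto
    show "to_weight_zero_gen (of_weight_zero_gen b) = b" for b :: "'a gen"
      by (cases b) auto
  qed
  \<comment> \<open>These zeros make each \<open>Y k\<close> commute with the surviving vertices and
    edges, as an isolated vertex does.\<close>
  have card0: "card ({i} \<inter> S ! m) = 0" if "i \<in> verts G'" "m < length S" for i m
    using that by (auto simp: verts)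
  have card0': "card ({i, j} \<inter> S ! m) = 0" if "{i, j} \<in> edges G'" "m < length S" for i j m
    using that by (auto simp: edges)
  \<comment> \<open>\<open>Inl\<close> preserves the order of the vertices, so the sign conventions
    for edge generators agree on both sides.\<close>
  have bracket: "graph_bracket ?H [] b c a =
      graph_bracket G S (to_weight_zero_gen b) (to_weight_zero_gen c) (to_weight_zero_gen a)"
    if "a \<in> lie_gens ?H []" "b \<in> lie_gens ?H []" "c \<in> lie_gens ?H []" for a b c
    using gens_cases[OF that(1)] gens_cases[OF that(2)] gens_cases[OF that(3)]
    by (elim disjE exE conjE)
      (simp_all add: graph_bracket_def gen_vec_def scaleR_fun_def card0 card0'
        edge_disjoint_union_edgeless Inl_less_Inl edges verts)
  have "vspace_iso (ce_cohomology L k) (ce_cohomology (based_lie_algebra (lie_gens ?H []) (graph_bracket ?H [])) k)"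
    by (rule vspace_iso_ce_cohomology_weight_zero[OF bij bracket])
      (use graph_bracket_closed[of _ ?H "[]"] in blast)+
  then show ?thesis by (simp only: graph_lie_algebra_eq)
qed

end
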